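(* There exists a profinite group $G$ such that $G$ is not prosoluble, $G$ is (topologically) finitely generated, and every coefficient $c_n(G)$, $n\ge 1$, of the formal Dirichlet series $(P_G(s))^{-1}=\sum_{n\ge 1} c_n(G)/n^s$ is nonnegative.
   Context: A profinite group is finitely generated if it is topologically generated by a finite number of elements; then for each positive integer $n$ it has only finitely many open subgroups of index $n$. For a finitely generated profinite group $G$, the Möbius function of the lattice of open subgroups of $G$ is defined recursively by $\mu(G,G)=1$ and $\sum_{H\le K\le G}\mu(K,G)=0$ for every proper open subgroup $H$ of $G$ (the sum is over the open subgroups $K$ of $G$ containing $H$). Put $a_n(G)=\sum_{|G:H|=n}\mu(H,G)$, the sum being over open subgroups $H$ of index $n$, and let $P_G(s)=\sum_{n\ge 1} a_n(G)/n^s$ as a formal Dirichlet series. Since $a_1(G)=1$, this has a formal inverse (with respect to multiplication of formal Dirichlet series, i.e. Dirichlet convolution of coefficients), denoted $(P_G(s))^{-1}=\sum_{n\ge 1}c_n(G)/n^s$; it is called the probabilistic zeta function of $G$. A profinite group is prosoluble if it is an inverse limit of finite soluble groups. *)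

theory Defs
  imports
    "HOL-Analysis.Analysis"
    "HOL-Algebra.Solvable_Groups"
    "HOL-Algebra.Product_Groups"
begin

section \<open>Topological groups and inverse limits\<close>

definition topological_group :: "'a monoid \<Rightarrow> 'a topology \<Rightarrow> bool" where
  "topological_group G T \<longleftrightarrow>
     group G \<and> topspace T = carrier G \<and>
     continuous_map (prod_topology T T) T (\<lambda>(x, y). x \<otimes>\<^bsub>G\<^esub> y) \<and>
     continuous_map T T (\<lambda>x. inv\<^bsub>G\<^esub> x)"

definition topological_group_isomorphic ::
  "'a monoid \<Rightarrow> 'a topology \<Rightarrow> 'b monoid \<Rightarrow> 'b topology \<Rightarrow> bool" where
  "topological_group_isomorphic G T H U \<longleftrightarrow> (\<exists>h. h \<in> iso G H \<and> homeomorphic_map T U h)"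

text \<open>\<open>(i, j) \<in> r\<close> is read as \<open>i \<le> j\<close>; the transition map \<open>\<phi> i j\<close> then goes from \<open>F j\<close> to \<open>F i\<close>.
  Transition maps need not be surjective.\<close>

definition inverse_system ::
  "'i set \<Rightarrow> 'i rel \<Rightarrow> ('i \<Rightarrow> 'b monoid) \<Rightarrow> ('i \<Rightarrow> 'i \<Rightarrow> 'b \<Rightarrow> 'b) \<Rightarrow> bool" where
  "inverse_system I r F \<phi> \<longleftrightarrow>
     I \<noteq> {} \<and> r \<subseteq> I \<times> I \<and> partial_order_on I r \<and>
     (\<forall>i\<in>I. \<forall>j\<in>I. \<exists>k\<in>I. (i, k) \<in> r \<and> (j, k) \<in> r) \<and>
     (\<forall>i\<in>I. group (F i)) \<and>
     (\<forall>i j. (i, j) \<in> r \<longrightarrow> \<phi> i j \<in> hom (F j) (F i)) \<and>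
     (\<forall>i\<in>I. \<forall>x\<in>carrier (F i). \<phi> i i x = x) \<and>
     (\<forall>i j k. (i, j) \<in> r \<longrightarrow> (j, k) \<in> r \<longrightarrow> (\<forall>x\<in>carrier (F k). \<phi> i j (\<phi> j k x) = \<phi> i k x))"

definition inverse_limit_carrier ::
  "'i set \<Rightarrow> 'i rel \<Rightarrow> ('i \<Rightarrow> 'b monoid) \<Rightarrow> ('i \<Rightarrow> 'i \<Rightarrow> 'b \<Rightarrow> 'b) \<Rightarrow> ('i \<Rightarrow> 'b) set" where
  "inverse_limit_carrier I r F \<phi> =
     {x \<in> (\<Pi>\<^sub>E i\<in>I. carrier (F i)). \<forall>i j. (i, j) \<in> r \<longrightarrow> \<phi> i j (x j) = x i}"

definition inverse_limit_group ::
  "'i set \<Rightarrow> 'i rel \<Rightarrow> ('i \<Rightarrow> 'b monoid) \<Rightarrow> ('i \<Rightarrow> 'i \<Rightarrow> 'b \<Rightarrow> 'b) \<Rightarrow> ('i \<Rightarrow> 'b) monoid" where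
  "inverse_limit_group I r F \<phi> = (product_group I F)\<lparr>carrier := inverse_limit_carrier I r F \<phi>\<rparr>"

definition inverse_limit_topology ::
  "'i set \<Rightarrow> 'i rel \<Rightarrow> ('i \<Rightarrow> 'b monoid) \<Rightarrow> ('i \<Rightarrow> 'i \<Rightarrow> 'b \<Rightarrow> 'b) \<Rightarrow> ('i \<Rightarrow> 'b) topology" where
  "inverse_limit_topology I r F \<phi> =
     subtopology (product_topology (\<lambda>i. discrete_topology (carrier (F i))) I)
       (inverse_limit_carrier I r F \<phi>)"

text \<open>\<open>G\<close> is an inverse limit of finite groups lying in the class \<open>C\<close>. HOL does not allow the types of
  the indices and of the members of the inverse system to be quantified inside a definition; both are
  taken to be \<open>'a set\<close>. For a class closed under isomorphisms and subgroups this is no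
  restriction: any such \<open>G\<close> is also the inverse limit of its quotients \<open>G Mod N\<close> by open normal
  subgroups \<open>N\<close>, indexed by \<open>N\<close>, and both \<open>N\<close> and the elements of \<open>G Mod N\<close> are of type
  \<open>'a set\<close>.\<close>

definition inverse_limit_of_finite :: "('a set monoid \<Rightarrow> bool) \<Rightarrow> 'a monoid \<Rightarrow> 'a topology \<Rightarrow> bool" where
  "inverse_limit_of_finite C G T \<longleftrightarrow>
     (\<exists>(I :: 'a set set) r (F :: 'a set \<Rightarrow> 'a set monoid) \<phi>.
        inverse_system I r F \<phi> \<and> (\<forall>i\<in>I. finite (carrier (F i)) \<and> C (F i)) \<and>
        topological_group_isomorphic G T (inverse_limit_group I r F \<phi>) (inverse_limit_topology I r F \<phi>))"

definition profinite_group :: "'a monoid \<Rightarrow> 'a topology \<Rightarrow> bool" where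
  "profinite_group G T \<longleftrightarrow> topological_group G T \<and> inverse_limit_of_finite (\<lambda>_. True) G T"

definition prosoluble_group :: "'a monoid \<Rightarrow> 'a topology \<Rightarrow> bool" where
  "prosoluble_group G T \<longleftrightarrow> profinite_group G T \<and> inverse_limit_of_finite solvable G T"

definition topologically_finitely_generated :: "'a monoid \<Rightarrow> 'a topology \<Rightarrow> bool" where
  "topologically_finitely_generated G T \<longleftrightarrow>
     (\<exists>S. finite S \<and> S \<subseteq> carrier G \<and> T closure_of (generate G S) = carrier G)"


section \<open>The Moebius function of the lattice of open subgroups\<close>

definition open_subgroup :: "'a monoid \<Rightarrow> 'a topology \<Rightarrow> 'a set \<Rightarrow> bool" where
  "open_subgroup G T H \<longleftrightarrow> subgroup H G \<and> openin T H"

text \<open>\<open>moebius G T H\<close> is \<open>\<mu>(H, G)\<close>. The finiteness test only serves termination, see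
  \<open>moebius_rec\<close> below; it always succeeds in a profinite group, where an open subgroup
  has finite index.\<close>

function moebius :: "'a monoid \<Rightarrow> 'a topology \<Rightarrow> 'a set \<Rightarrow> int" where
  "moebius G T H =
     (if H = carrier G then 1
      else if finite {K. open_subgroup G T K \<and> H \<subset> K}
      then - (\<Sum>K | open_subgroup G T K \<and> H \<subset> K. moebius G T K)
      else 0)"
  by auto
termination
proof (relation "Wellfounded.measure (\<lambda>(G, T, H). card {K. open_subgroup G T K \<and> H \<subset> K})")
  fix G :: "'a monoid" and T H K
  assume "finite {K. open_subgroup G T K \<and> H \<subset> K}" "K \<in> {K. open_subgroup G T K \<and> H \<subset> K}"
  then have "card {L. open_subgroup G T L \<and> K \<subset> L} < card {K. open_subgroup G T K \<and> H \<subset> K}"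
    by (intro psubset_card_mono) auto
  then show "((G, T, K), (G, T, H)) \<in> Wellfounded.measure (\<lambda>(G, T, H). card {K. open_subgroup G T K \<and> H \<subset> K})"
    by simp
qed simp

declare moebius.simps [simp del]

lemma moebius_top [simp]: "moebius G T (carrier G) = 1"
  by (simp add: moebius.simps)

lemma moebius_rec:
  assumes "H \<noteq> carrier G"
  shows "moebius G T H = - (\<Sum>K | open_subgroup G T K \<and> H \<subset> K. moebius G T K)"
proof (cases "finite {K. open_subgroup G T K \<and> H \<subset> K}")
  case True
  then show ?thesis using assms by (subst moebius.simps) simp
next
  case False
  then show ?thesis using assms by (subst moebius.simps) simp
qed

lemma sum_moebius_eq_0:
  assumes "open_subgroup G T H" "H \<noteq> carrier G" "finite {K. open_subgroup G T K \<and> H \<subseteq> K}"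
  shows "(\<Sum>K | open_subgroup G T K \<and> H \<subseteq> K. moebius G T K) = 0"
proof -
  have eq: "{K. open_subgroup G T K \<and> H \<subseteq> K} = insert H {K. open_subgroup G T K \<and> H \<subset> K}"
    using assms(1) by auto
  have "finite {K. open_subgroup G T K \<and> H \<subset> K}"
    using assms(3) unfolding eq by simp
  then show ?thesis
    unfolding eq by (simp add: moebius_rec[OF assms(2)])
qed


section \<open>Formal Dirichlet series\<close>

text \<open>A formal Dirichlet series is represented by its coefficient sequence; the value of the sequence
  at \<open>0\<close> plays no role.\<close>

definition dirichlet_convolution :: "(nat \<Rightarrow> int) \<Rightarrow> (nat \<Rightarrow> int) \<Rightarrow> nat \<Rightarrow> int" where
  "dirichlet_convolution a b n = (\<Sum>d | d dvd n. a d * b (n div d))"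

text \<open>The formal inverse of a series with \<open>a 1 = 1\<close>; see \<open>dirichlet_inverse_iff\<close> for
  existence and uniqueness.\<close>

function dirichlet_inverse :: "(nat \<Rightarrow> int) \<Rightarrow> nat \<Rightarrow> int" where
  "dirichlet_inverse a n =
     (if n = 0 then 0 else if n = 1 then 1
      else - (\<Sum>d | d dvd n \<and> d < n. a (n div d) * dirichlet_inverse a d))"
  by auto
termination by (relation "Wellfounded.measure snd") auto

declare dirichlet_inverse.simps [simp del]

lemma dirichlet_inverse_iff:
  assumes "a 1 = 1"
  shows "(\<forall>n\<ge>1. dirichlet_convolution a c n = (if n = 1 then 1 else 0)) \<longleftrightarrow>
         (\<forall>n\<ge>1. c n = dirichlet_inverse a n)"
proof -
  have conv: "dirichlet_convolution a c n = c n + (\<Sum>d | d dvd n \<and> d < n. a (n div d) * c d)"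
    if n: "n \<ge> 1" for c n
  proof -
    have "dirichlet_convolution a c n = (\<Sum>d | d dvd n. a (n div d) * c d)"
      unfolding dirichlet_convolution_def
      by (rule sum.reindex_bij_witness[of _ "\<lambda>d. n div d" "\<lambda>d. n div d"])
         (use n in \<open>auto elim!: dvdE\<close>)
    also have "{d. d dvd n} = insert n {d. d dvd n \<and> d < n}"
      using n by (auto dest: dvd_imp_le)
    also have "(\<Sum>d\<in>\<dots>. a (n div d) * c d) = c n + (\<Sum>d | d dvd n \<and> d < n. a (n div d) * c d)"
      using n assms by (subst sum.insert) auto
    finally show ?thesis .
  qed
  have proper_divisors_1: "{d. d dvd (1::nat) \<and> d < 1} = {}" by auto
  have inv: "dirichlet_convolution a (dirichlet_inverse a) n = (if n = 1 then 1 else 0)"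
    if "n \<ge> 1" for n
  proof (cases "n = 1")
    case True
    have "dirichlet_inverse a 1 = 1" by (subst dirichlet_inverse.simps) simp
    then show ?thesis
      using True conv[of 1 "dirichlet_inverse a"] unfolding proper_divisors_1 by simp
  next
    case False
    then show ?thesis
      using that conv[OF that, of "dirichlet_inverse a"] dirichlet_inverse.simps[of a n] by simp
  qed
  show ?thesis
  proof (intro iffI allI impI)
    fix n :: nat
    assume c: "\<forall>n\<ge>1. dirichlet_convolution a c n = (if n = 1 then 1 else 0)" and "n \<ge> 1"
    from \<open>n \<ge> 1\<close> show "c n = dirichlet_inverse a n"
    proof (induction n rule: less_induct)
      case (less n)
      have "(\<Sum>d | d dvd n \<and> d < n. a (n div d) * c d) =
            (\<Sum>d | d dvd n \<and> d < n. a (n div d) * dirichlet_inverse a d)"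
      proof (rule sum.cong[OF refl])
        fix d assume "d \<in> {d. d dvd n \<and> d < n}"
        moreover from this have "d \<ge> 1" by (cases d) auto
        ultimately show "a (n div d) * c d = a (n div d) * dirichlet_inverse a d"
          using less.IH[of d] by simp
      qed
      then show ?case
        using conv[OF less.prems, of c] conv[OF less.prems, of "dirichlet_inverse a"]
          inv[OF less.prems] c less.prems by simp
    qed
  next
    fix n :: nat
    assume c: "\<forall>n\<ge>1. c n = dirichlet_inverse a n" and n: "n \<ge> 1"
    have "(\<Sum>d | d dvd n \<and> d < n. a (n div d) * c d) =
          (\<Sum>d | d dvd n \<and> d < n. a (n div d) * dirichlet_inverse a d)"
    proof (rule sum.cong[OF refl])
      fix d assume "d \<in> {d. d dvd n \<and> d < n}"
      then have "d \<ge> 1" by (cases d) auto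
      then show "a (n div d) * c d = a (n div d) * dirichlet_inverse a d"
        using c by simp
    qed
    then show "dirichlet_convolution a c n = (if n = 1 then 1 else 0)"
      using conv[OF n, of c] conv[OF n, of "dirichlet_inverse a"] inv[OF n] c n by simp
  qed
qed


section \<open>The probabilistic zeta function\<close>

text \<open>\<open>P_coeff G T n\<close> is \<open>a\<^sub>n(G)\<close>. For a topologically finitely generated profinite group and
  \<open>n \<ge> 1\<close> the sum ranges over a finite set.\<close>

definition P_coeff :: "'a monoid \<Rightarrow> 'a topology \<Rightarrow> nat \<Rightarrow> int" where
  "P_coeff G T n = (\<Sum>H | open_subgroup G T H \<and> card (rcosets\<^bsub>G\<^esub> H) = n. moebius G T H)"

lemma P_coeff_1:
  assumes "topological_group G T"
  shows "P_coeff G T 1 = 1"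
proof -
  have grp: "group G" and top: "topspace T = carrier G"
    using assms by (simp_all add: topological_group_def)
  have "H = carrier G" if H: "subgroup H G" and card1: "card (rcosets\<^bsub>G\<^esub> H) = 1" for H
  proof -
    obtain A where A: "rcosets\<^bsub>G\<^esub> H = {A}" using card1 by (auto simp: card_1_singleton_iff)
    have "H \<in> rcosets\<^bsub>G\<^esub> H" by (rule subgroup.subgroup_in_rcosets[OF H grp])
    then have "rcosets\<^bsub>G\<^esub> H = {H}" using A by simp
    then show ?thesis using group.rcosets_part_G[OF grp H] by simp
  qed
  moreover have "open_subgroup G T (carrier G)"
    using openin_topspace[of T] grp top by (simp add: open_subgroup_def group.subgroup_self)
  moreover have "card (rcosets\<^bsub>G\<^esub> (carrier G)) = 1"
  proof -
    have "carrier G #>\<^bsub>G\<^esub> x = carrier G" if "x \<in> carrier G" for x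
      using that grp by (simp add: group.coset_join2 group.subgroup_self)
    moreover have "carrier G \<noteq> {}" using grp by (auto dest: group.is_monoid monoid.one_closed)
    ultimately have "rcosets\<^bsub>G\<^esub> (carrier G) = {carrier G}"
      unfolding RCOSETS_def by auto
    then show ?thesis by simp
  qed
  ultimately have "{H. open_subgroup G T H \<and> card (rcosets\<^bsub>G\<^esub> H) = 1} = {carrier G}"
    by (auto simp: open_subgroup_def)
  then show ?thesis by (simp add: P_coeff_def)
qed

definition prob_zeta_coeff :: "'a monoid \<Rightarrow> 'a topology \<Rightarrow> nat \<Rightarrow> int" where
  "prob_zeta_coeff G T = dirichlet_inverse (P_coeff G T)"

end

theory Submission
  imports Defs "HOL-Algebra.Sym_Groups"
begin

text \<open>
  \<open>G\<close> can be taken finite: the product of a finite insoluble group \<open>S\<close> (here \<open>Sym(5)\<close>) with \<open>C\<^sub>p\<^sup>k\<close> for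
  every prime \<open>p\<close> dividing the order of \<open>S\<close> and a suitable large \<open>k\<close>. If \<open>N\<close> is a normal subgroup of
  prime order \<open>p\<close> of \<open>G\<close> with \<open>h\<close> complements, then \<open>P\<^sub>G(s) = P\<^bsub>G/N\<^esub>(s) (1 - h / p\<^sup>s)\<close> (Gaschuetz), so
  \<open>1 / P\<^sub>G\<close> is \<open>1 / P\<^sub>S\<close> times a product \<open>E\<close> of geometric series \<open>1 / (1 - h / p\<^sup>s)\<close>. The numbers \<open>h\<close> are
  unbounded, as each factor \<open>C\<^sub>p\<close> multiplies the number of homomorphisms to \<open>C\<^sub>p\<close> at least by \<open>p\<close>; hence
  the coefficients of \<open>E\<close> can be made to satisfy \<open>E(dm) \<ge> d\<^sup>k E(m)\<close> for all \<open>d\<close> whose prime divisors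
  divide the order of \<open>S\<close>. The coefficients of \<open>1 / P\<^sub>S\<close> are supported on such \<open>d\<close> and grow
  only polynomially, so for large \<open>k\<close> the leading coefficient \<open>1\<close> dominates all the others in the
  convolution with \<open>E\<close>.
\<close>

section \<open>Dirichlet series\<close>

text \<open>Multiplication of the Dirichlet series of \<open>a\<close> by
  \<open>1 / p^s\<close>.\<close>

definition dirichlet_shift :: "nat \<Rightarrow> (nat \<Rightarrow> int) \<Rightarrow> nat \<Rightarrow> int" where
  "dirichlet_shift p a n = (if p dvd n then a (n div p) else 0)"

lemma dirichlet_convolution_commute:
  assumes "n \<ge> 1"
  shows "dirichlet_convolution a b n = dirichlet_convolution b a n"
  unfolding dirichlet_convolution_def
  by (rule sum.reindex_bij_witness[of _ "\<lambda>d. n div d" "\<lambda>d. n div d"])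
     (use assms in \<open>auto elim!: dvdE\<close>)

text \<open>For \<open>n = p * m\<close> the terms with \<open>p dvd n div d\<close> are those with
  \<open>d dvd m\<close>, so a factor \<open>1 / p^s\<close> can be pulled out of a product.\<close>

lemma dirichlet_convolution_shift_right:
  assumes "n \<ge> 1" "p \<ge> 1"
  shows "dirichlet_convolution a (dirichlet_shift p b) n = dirichlet_shift p (dirichlet_convolution a b) n"
proof (cases "p dvd n")
  case True
  then obtain m where m: "n = p * m" by blast
  have "dirichlet_convolution a (dirichlet_shift p b) n
      = (\<Sum>d | d dvd m. a d * dirichlet_shift p b (n div d))"
    unfolding dirichlet_convolution_def
  proof (rule sum.mono_neutral_right)
    show "finite {d. d dvd n}" using assms by simp
    show "{d. d dvd m} \<subseteq> {d. d dvd n}" using m by auto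
    have "d dvd m" if d: "d dvd n" "p dvd n div d" for d
    proof -
      obtain k where "n div d = p * k" using d(2) by blast
      then have "p * m = p * (d * k)" using d(1) m by (metis dvd_mult_div_cancel mult.left_commute)
      then show ?thesis using assms(2) by simp
    qed
    then show "\<forall>i\<in>{d. d dvd n} - {d. d dvd m}. a i * dirichlet_shift p b (n div i) = 0"
      by (auto simp: dirichlet_shift_def)
  qed
  also have "\<dots> = (\<Sum>d | d dvd m. a d * b (m div d))"
  proof (rule sum.cong[OF refl])
    fix d assume "d \<in> {d. d dvd m}"
    then have "n div d = p * (m div d)" using m by (simp add: div_mult_swap)
    then show "a d * dirichlet_shift p b (n div d) = a d * b (m div d)"
      using assms(2) by (simp add: dirichlet_shift_def)
  qed
  finally show ?thesis using m assms(2) by (simp add: dirichlet_shift_def dirichlet_convolution_def)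
next
  case False
  then have "\<not> p dvd n div d" if "d dvd n" for d
    using that by (metis dvd_div_mult_self dvd_mult2)
  then show ?thesis using False by (auto simp: dirichlet_shift_def dirichlet_convolution_def intro!: sum.neutral)
qed

lemma dirichlet_convolution_shift_left:
  assumes "n \<ge> 1" "p \<ge> 1"
  shows "dirichlet_convolution (dirichlet_shift p a) b n = dirichlet_shift p (dirichlet_convolution a b) n"
proof -
  have "dirichlet_convolution (dirichlet_shift p a) b n = dirichlet_shift p (dirichlet_convolution b a) n"
    using assms by (simp add: dirichlet_convolution_commute[of n _ b] dirichlet_convolution_shift_right)
  also have "\<dots> = dirichlet_shift p (dirichlet_convolution a b) n"
    using assms by (auto simp: dirichlet_shift_def elim!: dvdE intro!: dirichlet_convolution_commute)
  finally show ?thesis .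
qed

text \<open>The quotient of the Dirichlet series of \<open>c\<close> by \<open>1 - h / p\<^sup>s\<close>.\<close>

function euler_factor_div :: "nat \<Rightarrow> int \<Rightarrow> (nat \<Rightarrow> int) \<Rightarrow> nat \<Rightarrow> int" where
  "euler_factor_div p h c n =
     c n + (if p dvd n \<and> n > 0 \<and> p > 1 then h * euler_factor_div p h c (n div p) else 0)"
  by auto
termination by (relation "Wellfounded.measure (\<lambda>(p, h, c, n). n)") auto

declare euler_factor_div.simps [simp del]

lemma euler_factor_div_eq:
  assumes "n \<ge> 1" "p > 1"
  shows "euler_factor_div p h c n = c n + h * dirichlet_shift p (euler_factor_div p h c) n"
  using assms by (subst euler_factor_div.simps) (auto simp: dirichlet_shift_def)

lemma euler_factor_div_cong:
  assumes "\<And>n. n \<ge> 1 \<Longrightarrow> a n = b n" "n \<ge> 1"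
  shows "euler_factor_div p h a n = euler_factor_div p h b n"
  using assms(2)
proof (induction n rule: less_induct)
  case (less n)
  then show ?case
    using assms(1)[OF less.prems]
    by (subst (1 2) euler_factor_div.simps) (auto elim!: dvdE)
qed

text \<open>Both sides satisfy the recursion \<open>euler_factor_div_eq\<close>, which steps from
  \<open>n\<close> to \<open>n div p\<close>; hence induction on \<open>n\<close>.\<close>

lemma dirichlet_convolution_euler_factor_div:
  assumes "n \<ge> 1" "p > 1"
  shows "dirichlet_convolution c (euler_factor_div p h e) n
       = euler_factor_div p h (dirichlet_convolution c e) n"
  using assms(1)
proof (induction n rule: less_induct)
  case (less n)
  have pos: "n div d \<ge> 1" if "d dvd n" for d
    using less.prems that by (auto elim!: dvdE)
  have "dirichlet_convolution c (euler_factor_div p h e) n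
      = (\<Sum>d | d dvd n. c d * (e (n div d) + h * dirichlet_shift p (euler_factor_div p h e) (n div d)))"
    unfolding dirichlet_convolution_def
    by (rule sum.cong[OF refl]) (use pos assms(2) in \<open>auto simp: euler_factor_div_eq\<close>)
  also have "\<dots> = dirichlet_convolution c e n
      + h * dirichlet_convolution c (dirichlet_shift p (euler_factor_div p h e)) n"
    by (simp add: dirichlet_convolution_def algebra_simps sum.distrib sum_distrib_left)
  also have "dirichlet_convolution c (dirichlet_shift p (euler_factor_div p h e)) n
      = dirichlet_shift p (dirichlet_convolution c (euler_factor_div p h e)) n"
    using less.prems assms(2) by (intro dirichlet_convolution_shift_right) auto
  also have "\<dots> = dirichlet_shift p (euler_factor_div p h (dirichlet_convolution c e)) n"
    using less.prems assms(2) by (auto simp: dirichlet_shift_def intro!: less.IH elim!: dvdE)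
  finally show ?case using less.prems assms(2) by (simp add: euler_factor_div_eq)
qed

lemma dirichlet_convolution_inverse:
  assumes "a 1 = 1" "n \<ge> 1"
  shows "dirichlet_convolution a (dirichlet_inverse a) n = (if n = 1 then 1 else 0)"
  using dirichlet_inverse_iff[of a "dirichlet_inverse a", OF assms(1)] assms(2) by simp

text \<open>Inverting \<open>B = A (1 - h / p^s)\<close> gives
  \<open>1 / B = (1 / A) / (1 - h / p^s)\<close>: the candidate is checked to be an inverse of
  \<open>b\<close>, and inverses are unique.\<close>

lemma dirichlet_inverse_mult_euler_factor:
  assumes "a 1 = 1" "p > 1" and b: "\<And>n. n \<ge> 1 \<Longrightarrow> b n = a n - h * dirichlet_shift p a n"
    and n: "n \<ge> 1"
  shows "dirichlet_inverse b n = euler_factor_div p h (dirichlet_inverse a) n"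
proof -
  let ?c = "euler_factor_div p h (dirichlet_inverse a)"
  have "dirichlet_convolution b ?c n = (if n = 1 then 1 else 0)" if n: "n \<ge> 1" for n
  proof -
    have "b d = a d - h * dirichlet_shift p a d" if "d dvd n" for d
      using that n by (intro b) (auto elim!: dvdE)
    then have "dirichlet_convolution b ?c n
        = (\<Sum>d | d dvd n. (a d - h * dirichlet_shift p a d) * ?c (n div d))"
      unfolding dirichlet_convolution_def by (intro sum.cong) auto
    also have "\<dots> = dirichlet_convolution a ?c n - h * dirichlet_convolution (dirichlet_shift p a) ?c n"
      by (simp add: dirichlet_convolution_def algebra_simps sum_subtractf sum_distrib_left)
    also have "\<dots> = dirichlet_convolution a ?c n - h * dirichlet_shift p (dirichlet_convolution a ?c) n"
      using n assms(2) by (simp add: dirichlet_convolution_shift_left)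
    \<comment> \<open>Convolving \<open>a\<close> with \<open>?c\<close> gives the unit series
      divided by the Euler factor, so multiplying by \<open>1 - h / p^s\<close> returns the
      unit.\<close>
    also have "\<dots> = dirichlet_convolution a (dirichlet_inverse a) n"
    proof -
      have "dirichlet_shift p (dirichlet_convolution a ?c) n
          = dirichlet_shift p (euler_factor_div p h (dirichlet_convolution a (dirichlet_inverse a))) n"
        using n assms(2) by (auto simp: dirichlet_shift_def dirichlet_convolution_euler_factor_div elim!: dvdE)
      then show ?thesis using n assms(2)
        by (simp add: dirichlet_convolution_euler_factor_div euler_factor_div_eq[of n])
    qed
    finally show ?thesis using assms(1) n by (simp add: dirichlet_convolution_inverse)
  qed
  moreover have "b 1 = 1" using b[of 1] assms by (simp add: dirichlet_shift_def)
  ultimately show ?thesis using dirichlet_inverse_iff[of b ?c] n by simp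
qed

section \<open>Size and support of the inverse series\<close>

text \<open>In the recursion only divisors \<open>d\<close> of \<open>n\<close> with
  \<open>n div d\<close> dividing \<open>N\<close> contribute, so there are at most \<open>N\<close>
  terms. Each has \<open>d \<le> n / 2\<close>, which gains a factor \<open>2^t\<close> in
  \<open>d^t\<close>, and this absorbs \<open>M * N\<close>.\<close>

lemma dirichlet_inverse_bound:
  assumes supp: "\<And>m. a m \<noteq> 0 \<Longrightarrow> m dvd N" and N: "N > 0" and bd: "\<And>m. \<bar>a m\<bar> \<le> M"
    and M: "0 \<le> M" "M * int N \<le> 2 ^ t" and n: "n \<ge> 1"
  shows "\<bar>dirichlet_inverse a n\<bar> \<le> int n ^ t"
  using n
proof (induction n rule: less_induct)
  case (less n)
  show ?case
  proof (cases "n = 1")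
    case True then show ?thesis by (subst dirichlet_inverse.simps) simp
  next
    case False
    let ?D = "{d. d dvd n \<and> d < n}" and ?D' = "{d. d dvd n \<and> d < n \<and> n div d dvd N}"
    have "dirichlet_inverse a n = - (\<Sum>d\<in>?D. a (n div d) * dirichlet_inverse a d)"
      using less.prems False by (subst dirichlet_inverse.simps) simp
    also have "(\<Sum>d\<in>?D. a (n div d) * dirichlet_inverse a d)
        = (\<Sum>d\<in>?D'. a (n div d) * dirichlet_inverse a d)"
      by (rule sum.mono_neutral_right) (use supp in auto)
    finally have "\<bar>dirichlet_inverse a n\<bar> \<le> (\<Sum>d\<in>?D'. \<bar>a (n div d) * dirichlet_inverse a d\<bar>)"
      by (simp add: sum_abs)
    \<comment> \<open>Multiplying by \<open>2 ^ t\<close> avoids division in the integers.\<close>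
    also have "2 ^ t * \<dots> \<le> (\<Sum>d\<in>?D'. M * int n ^ t)"
      unfolding sum_distrib_left
    proof (rule sum_mono)
      fix d assume d: "d \<in> ?D'"
      then have d1: "d \<ge> 1" using less.prems by (auto intro!: Nat.gr0I)
      have "2 * d \<le> n" using d less.prems by (auto elim!: dvdE)
      then have "(2 * int d) ^ t \<le> int n ^ t" by (intro power_mono) auto
      moreover have "\<bar>dirichlet_inverse a d\<bar> \<le> int d ^ t" using d d1 by (intro less.IH) auto
      ultimately have "2 ^ t * \<bar>dirichlet_inverse a d\<bar> \<le> int n ^ t"
        unfolding power_mult_distrib by (smt (verit) mult_left_mono zero_le_power)
      then have "\<bar>a (n div d)\<bar> * (2 ^ t * \<bar>dirichlet_inverse a d\<bar>) \<le> M * int n ^ t"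
        using bd M by (intro mult_mono) auto
      then show "2 ^ t * \<bar>a (n div d) * dirichlet_inverse a d\<bar> \<le> M * int n ^ t"
        by (simp add: abs_mult mult.left_commute)
    qed
    also have "\<dots> \<le> 2 ^ t * int n ^ t"
    proof -
      have "card ?D' \<le> card {m. m dvd N}"
      proof (rule card_inj_on_le)
        show "inj_on (\<lambda>d. n div d) ?D'"
        proof (rule inj_onI)
          fix d e assume de: "d \<in> ?D'" "e \<in> ?D'" "n div d = n div e"
          then have "d * (n div d) = n" "e * (n div d) = n" by auto
          then have "d * (n div d) = e * (n div d)" by simp
          moreover have "n div d \<noteq> 0" using de(1) less.prems by (auto elim!: dvdE)
          ultimately show "d = e" by simp
        qed
      qed (use N in auto)
      also have "\<dots> \<le> card {1..N}"
        by (rule card_mono) (use N in \<open>auto dest: dvd_imp_le intro: Nat.gr0I\<close>)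
      finally have "int (card ?D') * M \<le> int N * M" using M by (intro mult_right_mono) auto
      also have "\<dots> \<le> 2 ^ t" using M by (simp add: mult.commute)
      finally have "int (card ?D') * M * int n ^ t \<le> 2 ^ t * int n ^ t" by (intro mult_right_mono) auto
      then show ?thesis by (simp add: mult.assoc)
    qed
    finally show ?thesis by simp
  qed
qed

text \<open>A nonzero value forces a nonzero term of the recursion. A prime divisor of
  \<open>n\<close> divides \<open>d\<close> or \<open>n div d\<close> there; the first case is the
  induction hypothesis, the second is \<open>supp\<close>.\<close>

lemma dirichlet_inverse_support:
  assumes supp: "\<And>m. a m \<noteq> 0 \<Longrightarrow> m dvd N" 
    and n: "dirichlet_inverse a n \<noteq> 0" "prime p" "p dvd n"
  shows "p dvd N"
  using n
proof (induction n rule: less_induct)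
  case (less n)
  have "n \<noteq> 0" using less.prems(1) by (cases n) (auto simp: dirichlet_inverse.simps[of _ 0])
  moreover have "n \<noteq> 1" using less.prems(2,3) by auto
  ultimately have n: "n > 0" "n \<noteq> 1" by auto
  then have "(\<Sum>d | d dvd n \<and> d < n. a (n div d) * dirichlet_inverse a d) \<noteq> 0"
    using less.prems(1) by (subst (asm) dirichlet_inverse.simps) auto
  then obtain d where d: "d dvd n" "d < n" "a (n div d) \<noteq> 0" "dirichlet_inverse a d \<noteq> 0"
    by (rule sum.not_neutral_contains_not_neutral) auto
  have "p dvd d \<or> p dvd n div d"
    using less.prems d(1) by (metis dvd_mult_div_cancel prime_dvd_mult_iff)
  then show ?case using less.IH[OF d(2) d(4)] less.prems(2) supp[OF d(3)] by (meson dvd_trans)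
qed

section \<open>Nonnegativity of a convolution by domination\<close>

text \<open>Telescoping, since \<open>1 / (n + 1)^2 \<le> 1 / n - 1 / (n + 1)\<close>.\<close>

lemma sum_inverse_squares_le_1: "(\<Sum>d = 2..n. 1 / real d ^ 2) \<le> 1 - 1 / real n" if "n \<ge> 1"
  using that
proof (induction n rule: dec_induct)
  case (step n)
  have "1 / real (Suc n) ^ 2 \<le> 1 / (real n * real (Suc n))"
    using step.hyps by (intro divide_left_mono) (auto simp: power2_eq_square intro: mult_right_mono)
  also have "\<dots> = 1 / real n - 1 / real (Suc n)" using step.hyps by (simp add: field_simps)
  finally show ?case using step by simp
qed simp

text \<open>The term \<open>d = 1\<close> contributes \<open>E n\<close>. For the other nonzero
  terms \<open>\<bar>c d\<bar> \<le> d^t\<close>, while \<open>E n\<close> is at least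
  \<open>d^(t + 2)\<close> times \<open>E (n div d)\<close>; so they are at most
  \<open>E n / d^2\<close> in absolute value and sum to at most \<open>E n\<close>.\<close>

lemma dirichlet_convolution_nonneg:
  assumes c1: "c 1 = 1" and c: "\<And>n. n \<ge> 1 \<Longrightarrow> \<bar>c n\<bar> \<le> int n ^ t"
    and supp: "\<And>n p. c n \<noteq> 0 \<Longrightarrow> prime p \<Longrightarrow> p dvd n \<Longrightarrow> p \<in> A"
    and E: "\<And>n. n \<ge> 1 \<Longrightarrow> E n \<ge> 0"
    and grow: "\<And>p m. p \<in> A \<Longrightarrow> m \<ge> 1 \<Longrightarrow> E (p * m) \<ge> int p ^ (t + 2) * E m"
    and n: "n \<ge> 1"
  shows "dirichlet_convolution c E n \<ge> 0"
proof -
  \<comment> \<open>Growth along the primes of \<open>A\<close> multiplies up to growth along every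
    \<open>d\<close> whose prime divisors lie in \<open>A\<close>.\<close>
  have grow': "E (d * m) \<ge> int d ^ (t + 2) * E m"
    if "d \<ge> 1" "m \<ge> 1" "\<And>p. prime p \<Longrightarrow> p dvd d \<Longrightarrow> p \<in> A" for d m
    using that
  proof (induction d rule: less_induct)
    case (less d)
    show ?case
    proof (cases "d = 1")
      case False
      then obtain p where p: "prime p" "p dvd d" using prime_factor_nat by blast
      then obtain k where k: "d = p * k" by blast
      have k1: "k \<ge> 1" "k < d" using less.prems(1) k p prime_gt_1_nat[of p] by auto
      have "int d ^ (t + 2) * E m = int p ^ (t + 2) * (int k ^ (t + 2) * E m)"
        using k by (simp add: power_mult_distrib)
      also have "\<dots> \<le> int p ^ (t + 2) * E (k * m)"
        using less.IH[of k] k1 less.prems k by (intro mult_left_mono) auto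
      also have "\<dots> \<le> E (p * (k * m))" using grow[of p "k * m"] less.prems p k1 by simp
      finally show ?thesis using k by (simp add: mult.assoc)
    qed simp
  qed
  have bound: "real_of_int \<bar>c d * E (n div d)\<bar> \<le> real_of_int (E n) * (1 / real d ^ 2)"
    if d: "d dvd n" for d
  proof (cases "c d = 0")
    case True then show ?thesis using E[OF n] by simp
  next
    case False
    have d1: "d \<ge> 1" "n div d \<ge> 1" using n d by (auto elim!: dvdE)
    have "\<bar>c d * E (n div d)\<bar> * int d ^ 2 \<le> int d ^ t * E (n div d) * int d ^ 2"
      using c[OF d1(1)] E[OF d1(2)] by (intro mult_right_mono) (auto simp: abs_mult intro: mult_right_mono)
    also have "\<dots> = int d ^ (t + 2) * E (n div d)" by (simp add: power_add power2_eq_square)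
    also have "\<dots> \<le> E n" using grow'[of d "n div d"] d1 supp[OF False] d by simp
    finally have "real_of_int (\<bar>c d * E (n div d)\<bar> * int d ^ 2) \<le> real_of_int (E n)"
      by (simp only: of_int_le_iff)
    then show ?thesis using d1 by (simp add: field_simps)
  qed
  have "real_of_int \<bar>\<Sum>d | d dvd n \<and> d \<noteq> 1. c d * E (n div d)\<bar>
      \<le> (\<Sum>d | d dvd n \<and> d \<noteq> 1. real_of_int \<bar>c d * E (n div d)\<bar>)"
    by (simp only: of_int_sum[symmetric] of_int_le_iff sum_abs)
  also have "\<dots> \<le> (\<Sum>d | d dvd n \<and> d \<noteq> 1. real_of_int (E n) * (1 / real d ^ 2))"
    by (rule sum_mono) (use bound in auto)
  also have "\<dots> \<le> (\<Sum>d = 2..n. real_of_int (E n) * (1 / real d ^ 2))"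
  proof (rule sum_mono2)
    show "{d. d dvd n \<and> d \<noteq> 1} \<subseteq> {2..n}"
    proof safe
      fix d assume "d dvd n" "d \<noteq> 1"
      then show "d \<in> {2..n}" using n dvd_imp_le[of d n] by (cases d) auto
    qed
  qed (use E[OF n] in auto)
  also have "\<dots> \<le> real_of_int (E n) * 1"
    unfolding sum_distrib_left[symmetric]
    using sum_inverse_squares_le_1[OF n] E[OF n] by (intro mult_left_mono) (auto intro: order_trans)
  finally have "\<bar>\<Sum>d | d dvd n \<and> d \<noteq> 1. c d * E (n div d)\<bar> \<le> E n"
    by (simp only: mult_1_right of_int_le_iff)
  moreover have "dirichlet_convolution c E n = E n + (\<Sum>d | d dvd n \<and> d \<noteq> 1. c d * E (n div d))"
  proof -
    have "{d. d dvd n} = insert 1 {d. d dvd n \<and> d \<noteq> 1}" by auto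
    moreover have "finite {d. d dvd n \<and> d \<noteq> 1}" using n by auto
    ultimately show ?thesis unfolding dirichlet_convolution_def using n c1 by simp
  qed
  ultimately show ?thesis by linarith
qed

section \<open>Growth of series under division by Euler factors\<close>

lemma euler_factor_div_nonneg:
  assumes "\<And>n. n \<ge> 1 \<Longrightarrow> E n \<ge> 0" "h \<ge> 0" "n \<ge> 1"
  shows "euler_factor_div p h E n \<ge> 0"
  using assms(3)
proof (induction n rule: less_induct)
  case (less n)
  show ?case using assms(1)[OF less.prems] assms(2) less
    by (subst euler_factor_div.simps) (auto elim!: dvdE)
qed

text \<open>The recursion at \<open>p * m\<close> has as one summand \<open>h\<close> times the
  value at \<open>m\<close>, and the other summand \<open>E (p * m)\<close> is nonnegative.\<close>

lemma euler_factor_div_growth_same: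
  assumes "\<And>n. n \<ge> 1 \<Longrightarrow> E n \<ge> 0" "p > 1" "0 \<le> w" "w \<le> h" "m \<ge> 1"
  shows "euler_factor_div p h E (p * m) \<ge> w * euler_factor_div p h E m"
proof -
  have "w * euler_factor_div p h E m \<le> h * euler_factor_div p h E m"
    using assms by (intro mult_right_mono euler_factor_div_nonneg) auto
  then show ?thesis using assms
    by (subst euler_factor_div.simps[of _ _ _ "p * m"]) (auto intro: add_increasing)
qed

text \<open>Growth already achieved for a prime \<open>q\<close> survives division by the factor of
  another prime: both summands of the recursion at \<open>q * m\<close> grow by \<open>w\<close>,
  the second by induction on \<open>m\<close>.\<close>

lemma euler_factor_div_growth:
  assumes E: "\<And>n. n \<ge> 1 \<Longrightarrow> E n \<ge> 0" and p: "prime p" and q: "prime q" and h: "h \<ge> 0"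
    and grow: "\<And>m. m \<ge> 1 \<Longrightarrow> E (q * m) \<ge> w * E m" and pq: "p \<noteq> q" and m: "m \<ge> 1"
  shows "euler_factor_div p h E (q * m) \<ge> w * euler_factor_div p h E m"
  using m
proof (induction m rule: less_induct)
  case (less m)
  have p1: "p > 1" using p by (rule prime_gt_1_nat)
  have q1: "q \<ge> 1" using prime_gt_1_nat[OF q] by simp
  have dvd: "p dvd q * m \<longleftrightarrow> p dvd m" using p q pq by (simp add: prime_dvd_mult_iff primes_dvd_imp_eq) 
      (metis primes_dvd_imp_eq)
  show ?case
  proof (cases "p dvd m")
    case True
    then obtain k where k: "m = p * k" by blast
    have "w * euler_factor_div p h E k \<le> euler_factor_div p h E (q * k)"
      using k less.prems p1 by (intro less.IH) auto
    then have "h * (w * euler_factor_div p h E k) \<le> h * euler_factor_div p h E (q * k)"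
      using h by (rule mult_left_mono)
    moreover have "euler_factor_div p h E (q * m) = E (q * m) + h * euler_factor_div p h E (q * k)"
      using k less.prems p1 q1
      by (subst euler_factor_div.simps) (simp add: mult.left_commute[of q p])
    moreover have "euler_factor_div p h E m = E m + h * euler_factor_div p h E k"
      using k less.prems p1 by (subst euler_factor_div.simps) simp
    ultimately show ?thesis using grow[OF less.prems] by (simp add: algebra_simps)
  next
    case False
    then show ?thesis using grow[OF less.prems] dvd
      by (simp add: euler_factor_div.simps[of _ _ _ "q * m"] euler_factor_div.simps[of _ _ _ m])
  qed
qed


section \<open>Kernels of prime order\<close>

abbreviation disc :: "('a, 'b) monoid_scheme \<Rightarrow> 'a topology" where
  "disc G \<equiv> discrete_topology (carrier G)"

lemma open_subgroup_discrete [simp]: "open_subgroup G (disc G) H \<longleftrightarrow> subgroup H G"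
  by (auto simp: open_subgroup_def dest: subgroup.subset)

lemma topological_group_discrete:
  assumes "group G"
  shows "topological_group G (disc G)"
proof -
  interpret group G by fact
  have "prod_topology (disc G) (disc G) = discrete_topology (carrier G \<times> carrier G)"
    by (simp add: prod_topology_discrete_topology)
  then show ?thesis unfolding topological_group_def
    using assms by (auto simp: Pi_iff)
qed

lemma finite_subgroups:
  assumes "finite (carrier G)"
  shows "finite {H. subgroup H G \<and> P H}"
  by (rule finite_subset[of _ "Pow (carrier G)"]) (use assms in \<open>auto dest: subgroup.subset\<close>)

lemma sum_moebius_discrete:
  assumes "group G" "finite (carrier G)" "subgroup H G"
  shows "(\<Sum>K | subgroup K G \<and> H \<subseteq> K. moebius G (disc G) K) = (if H = carrier G then 1 else 0)"
proof (cases "H = carrier G")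
  case True
  then have "{K. subgroup K G \<and> H \<subseteq> K} = {carrier G}"
    using assms(1) by (auto dest: subgroup.subset intro: group.subgroup_self)
  then show ?thesis using True by simp
next
  case False
  then show ?thesis
    using sum_moebius_eq_0[of G "disc G" H] assms finite_subgroups[OF assms(2)] by simp
qed

text \<open>Downward induction from \<open>carrier G\<close>: the sum condition at \<open>H\<close>
  expresses \<open>m H\<close> through the values at strictly larger subgroups, just as for
  \<open>moebius\<close>.\<close>

lemma moebius_discrete_unique:
  assumes "group G" and fin: "finite (carrier G)"
    and m: "\<And>H. subgroup H G \<Longrightarrow> (\<Sum>K | subgroup K G \<and> H \<subseteq> K. m K) = (if H = carrier G then 1 else 0)"
    and "subgroup H G"
  shows "moebius G (disc G) H = m H"
  using assms(4)
proof (induction "card (carrier G) - card H" arbitrary: H rule: less_induct)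
  case less
  let ?A = "{K. subgroup K G \<and> H \<subset> K}"
  have A: "{K. subgroup K G \<and> H \<subseteq> K} = insert H ?A" using less.prems by auto
  have finA: "finite ?A" using finite_subgroups[OF fin] .
  have "(\<Sum>K\<in>?A. moebius G (disc G) K) = (\<Sum>K\<in>?A. m K)"
  proof (rule sum.cong[OF refl])
    fix K assume K: "K \<in> ?A"
    then have "K \<subseteq> carrier G" by (auto dest: subgroup.subset)
    then have "card H < card K" "card K \<le> card (carrier G)"
      using K fin by (auto intro: psubset_card_mono card_mono finite_subset)
    then show "moebius G (disc G) K = m K" using K by (intro less.hyps) auto
  qed
  moreover have "(\<Sum>K\<in>insert H ?A. moebius G (disc G) K) = (\<Sum>K\<in>insert H ?A. m K)"
    using m[OF less.prems] sum_moebius_discrete[OF assms(1) fin less.prems] unfolding A by simp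
  ultimately show ?case using finA by simp
qed

lemma (in group) card_rcosets_eq_iff:
  assumes "subgroup K G" "finite (carrier G)"
  shows "card (rcosets K) = n \<longleftrightarrow> n * card K = card (carrier G)"
proof -
  have "card K \<noteq> 0"
    using assms subgroup.subset subgroup.one_closed finite_subset by (metis card_eq_0_iff empty_iff)
  then show ?thesis using lagrange_finite[OF assms(2,1)] by (metis mult_right_cancel order_def)
qed

text \<open>By Lagrange the index condition becomes an equation of cardinalities, which is easy to
  transport along homomorphisms.\<close>

lemma P_coeff_discrete:
  assumes "group G" "finite (carrier G)"
  shows "P_coeff G (disc G) n
       = (\<Sum>H | subgroup H G \<and> n * card H = card (carrier G). moebius G (disc G) H)"
  unfolding P_coeff_def
  by (rule sum.cong) (use group.card_rcosets_eq_iff[OF assms(1)] assms(2) in auto)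

section \<open>Subgroups and their orders under homomorphisms\<close>

lemma (in group) subgroup_card_dvd:
  assumes "subgroup H G" "subgroup K G" "H \<subseteq> K" "finite K"
  shows "card H dvd card K"
proof -
  have "subgroup H (G\<lparr>carrier := K\<rparr>)" using assms(1-3) by (intro subgroup_incl)
  then have "card (rcosets\<^bsub>G\<lparr>carrier := K\<rparr>\<^esub> H) * card H = order (G\<lparr>carrier := K\<rparr>)"
    using assms(2,4) by (intro group.lagrange_finite subgroup_imp_group) auto
  then have "card K = card (rcosets\<^bsub>G\<lparr>carrier := K\<rparr>\<^esub> H) * card H" by (simp add: order_def)
  then show ?thesis by simp
qed

lemma (in group_hom) subgroup_vimage_Int:
  assumes "subgroup M G" "subgroup L H"
  shows "subgroup {x \<in> M. h x \<in> L} G"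
proof -
  interpret M: subgroup M G by fact
  interpret L: subgroup L H by fact
  show ?thesis by unfold_locales auto
qed

lemma (in group_hom) image_vimage_Int:
  assumes "h ` M = carrier H" "subgroup L H"
  shows "h ` {x \<in> M. h x \<in> L} = L"
  using assms(1) subgroup.subset[OF assms(2)] by auto

text \<open>Elements of \<open>M\<close> with the same image under \<open>h\<close> differ by an
  element of \<open>M \<inter> kernel G H h\<close>, hence of \<open>K\<close>.\<close>

lemma (in group_hom) vimage_Int_image:
  assumes M: "subgroup M G" and K: "subgroup K G" and ker: "M \<inter> kernel G H h \<subseteq> K" and KM: "K \<subseteq> M"
  shows "{x \<in> M. h x \<in> h ` K} = K"
proof (intro equalityI subsetI)
  fix x assume "x \<in> {x \<in> M. h x \<in> h ` K}"
  then obtain y where xy: "x \<in> M" "y \<in> K" "h x = h y" by auto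
  then have c: "x \<in> carrier G" "y \<in> carrier G" using M K by (auto dest: subgroup.subset)
  have "x \<otimes> inv y \<in> M" using xy M KM by (auto simp: subgroup_def)
  moreover have "x \<otimes> inv y \<in> kernel G H h" using xy c by (simp add: kernel_def)
  ultimately have "x \<otimes> inv y \<in> K" using ker by auto
  then have "x \<otimes> inv y \<otimes> y \<in> K" using xy K by (auto simp: subgroup_def)
  then show "x \<in> K" using c by (simp add: G.m_assoc)
qed (use KM in auto)

text \<open>Correspondence theorem for the restriction of \<open>h\<close> to \<open>M\<close>. The
  version relative to \<open>M\<close> serves both \<open>M = carrier G\<close> and the complements
  of the kernel.\<close>

lemma (in group_hom) sum_subgroups_image:
  assumes M: "subgroup M G" and surj: "h ` M = carrier H"
    and QR: "\<And>K. subgroup K G \<Longrightarrow> M \<inter> kernel G H h \<subseteq> K \<Longrightarrow> K \<subseteq> M \<Longrightarrow> Q K \<longleftrightarrow> R (h ` K)"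
  shows "(\<Sum>K | subgroup K G \<and> M \<inter> kernel G H h \<subseteq> K \<and> K \<subseteq> M \<and> Q K. g (h ` K))
       = (\<Sum>L | subgroup L H \<and> R L. g L)"
proof (rule sum.reindex_bij_witness[of _ "\<lambda>L. {x \<in> M. h x \<in> L}" "\<lambda>K. h ` K"])
  fix L assume L: "L \<in> {L. subgroup L H \<and> R L}"
  have "M \<inter> kernel G H h \<subseteq> {x \<in> M. h x \<in> L}"
    using L by (auto simp: kernel_def subgroup.one_closed)
  then show "{x \<in> M. h x \<in> L} \<in> {K. subgroup K G \<and> M \<inter> kernel G H h \<subseteq> K \<and> K \<subseteq> M \<and> Q K}"
    using L QR[of "{x \<in> M. h x \<in> L}"] subgroup_vimage_Int[OF M, of L] image_vimage_Int[OF surj, of L]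
    by auto
qed (use vimage_Int_image[OF M] image_vimage_Int[OF surj] QR in \<open>auto intro: subgroup_img_is_subgroup\<close>)

text \<open>The fibres of \<open>h\<close> on \<open>K\<close> are translates of \<open>N\<close>,
  so all have the same size.\<close>

lemma (in group_hom) card_eq_card_image:
  assumes K: "subgroup K G" and fin: "finite K" and ker: "N = K \<inter> kernel G H h"
  shows "card K = card N * card (h ` K)"
proof -
  have "card {x \<in> K. h x = y} = card N" if y: "y \<in> h ` K" for y
  proof -
    obtain z where z: "z \<in> K" "h z = y" using y by auto
    have K': "x \<in> carrier G" if "x \<in> K" for x using K that by (rule subgroup.mem_carrier)
    have "bij_betw (\<lambda>x. x \<otimes> z) N {x \<in> K. h x = y}"
      by (rule bij_betw_byWitness[where f' = "\<lambda>x. x \<otimes> inv z"])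
        (use z K K' in \<open>auto simp: ker kernel_def G.m_assoc subgroup.m_closed subgroup.m_inv_closed\<close>)
    then show ?thesis by (simp add: bij_betw_same_card)
  qed
  then have "(\<Sum>y\<in>h ` K. card {x \<in> K. h x = y}) = card N * card (h ` K)" by simp
  moreover have "(\<Sum>y\<in>h ` K. card {x \<in> K. h x = y}) = card K"
    using sum.image_gen[OF fin, of "\<lambda>_. 1 :: nat" h] by simp
  ultimately show ?thesis by simp
qed


section \<open>Gaschuetz's formula for a kernel of prime order\<close>

text \<open>For a kernel of prime order, being proper and mapping onto \<open>H\<close> forces
  trivial intersection with the kernel (\<open>complement_Int_kernel\<close>), so these are the
  complements in the usual sense.\<close>

definition complements :: "('a, 'b) monoid_scheme \<Rightarrow> ('c, 'd) monoid_scheme \<Rightarrow> ('a \<Rightarrow> 'c) \<Rightarrow> 'a set set" where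
  "complements G H h = {M. subgroup M G \<and> h ` M = carrier H \<and> M \<noteq> carrier G}"

locale prime_kernel_hom = group_hom G H h
  for G :: "'a monoid" (structure) and H :: "'b monoid" (structure) and h +
  assumes finite_carrier: "finite (carrier G)"
    and surj: "h ` carrier G = carrier H"
    and prime_card_kernel: "prime (card (kernel G H h))"
begin

abbreviation "N \<equiv> kernel G H h"

lemma finite_image: "finite (carrier H)"
  using finite_carrier surj by (metis finite_imageI)

lemma finite_complements: "finite (complements G H h)"
  unfolding complements_def by (rule finite_subgroups[OF finite_carrier])

text \<open>A subgroup containing the kernel is the full preimage of its image.\<close>

lemma eq_carrier_if_kernel_subset:
  assumes "subgroup M G" "h ` M = carrier H" "N \<subseteq> M"
  shows "M = carrier G"
proof -
  have "{x \<in> carrier G. h x \<in> h ` M} = M"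
    using assms by (intro vimage_Int_image G.subgroup_self subgroup.subset) auto
  then show ?thesis using assms(2) by auto
qed

lemma Int_kernel_trivial:
  assumes K: "subgroup K G" and "\<not> N \<subseteq> K"
  shows "K \<inter> N = {\<one>}"
proof -
  have fin: "finite N" using finite_carrier by (auto simp: kernel_def)
  have KN: "subgroup (K \<inter> N) G" by (intro G.subgroups_Inter_pair K subgroup_kernel)
  then have "card (K \<inter> N) dvd card N" using fin by (intro G.subgroup_card_dvd subgroup_kernel) auto
  then consider "card (K \<inter> N) = 1" | "card (K \<inter> N) = card N"
    using prime_card_kernel by (auto simp: prime_nat_iff)
  then show ?thesis
  proof cases
    case 1
    then show ?thesis using subgroup.one_closed[OF KN] by (metis card_1_singletonE singletonD)
  next
    case 2
    then have "K \<inter> N = N" using fin by (intro card_subset_eq) auto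
    then show ?thesis using assms(2) by auto
  qed
qed

lemma complement_Int_kernel:
  assumes "M \<in> complements G H h"
  shows "M \<inter> N = {\<one>}"
  using assms eq_carrier_if_kernel_subset[of M] by (intro Int_kernel_trivial) (auto simp: complements_def)

lemma card_complement:
  assumes M: "M \<in> complements G H h"
  shows "card M = card (carrier H)"
proof -
  have "subgroup M G" "h ` M = carrier H" using M by (auto simp: complements_def)
  moreover have "finite M" using subgroup.subset[OF \<open>subgroup M G\<close>] finite_carrier by (rule finite_subset)
  ultimately show ?thesis using card_eq_card_image[of M "{\<one>}"] complement_Int_kernel[OF M] by simp
qed

lemma card_carrier: "card (carrier G) = card N * card (carrier H)"
  using card_eq_card_image[OF G.subgroup_self finite_carrier] surj by (auto simp: kernel_def Int_def)

text \<open>In the sum of this function over the overgroups of \<open>K\<close> the first part contributes \<open>1\<close> if \<open>K\<close> maps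
  onto \<open>H\<close>, and the second part cancels this exactly if \<open>K\<close> is a complement of the kernel. As a subgroup
  mapping onto \<open>H\<close> is either a complement or all of \<open>G\<close>, these are the sums that characterise the
  Moebius function of \<open>G\<close>.\<close>

definition lifted_moebius :: "'a set \<Rightarrow> int" where
  "lifted_moebius K = (if N \<subseteq> K then moebius H (disc H) (h ` K) else 0)
     - (\<Sum>M | M \<in> complements G H h \<and> K \<subseteq> M. moebius H (disc H) (h ` K))"

lemma complement_kernel_subset:
  assumes "M \<in> complements G H h" "subgroup K G"
  shows "M \<inter> N \<subseteq> K"
  using complement_Int_kernel[OF assms(1)] subgroup.one_closed[OF assms(2)] by auto

text \<open>The sum over \<open>K\<close> is interchanged with the one over complements. The
  conditions on \<open>K\<close> are written so that \<open>sum_subgroups_image\<close> applies to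
  each sum, with \<open>M = carrier G\<close> in the first.\<close>

lemma sum_lifted_moebius:
  "(\<Sum>K | subgroup K G \<and> Q K. lifted_moebius K)
     = (\<Sum>K | subgroup K G \<and> carrier G \<inter> N \<subseteq> K \<and> K \<subseteq> carrier G \<and> Q K. moebius H (disc H) (h ` K))
       - (\<Sum>M\<in>complements G H h. \<Sum>K | subgroup K G \<and> M \<inter> N \<subseteq> K \<and> K \<subseteq> M \<and> Q K. moebius H (disc H) (h ` K))"
proof -
  let ?S = "{K. subgroup K G \<and> Q K}" and ?\<mu> = "\<lambda>K. moebius H (disc H) (h ` K)"
  have fin: "finite ?S" by (rule finite_subgroups[OF finite_carrier])
  have N: "carrier G \<inter> N = N" by (auto simp: kernel_def)
  have "(\<Sum>K\<in>?S. if N \<subseteq> K then ?\<mu> K else 0) = (\<Sum>K | K \<in> ?S \<and> N \<subseteq> K. ?\<mu> K)"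
    using fin by (rule sum.inter_filter[symmetric])
  also have "{K. K \<in> ?S \<and> N \<subseteq> K} = {K. subgroup K G \<and> carrier G \<inter> N \<subseteq> K \<and> K \<subseteq> carrier G \<and> Q K}"
    unfolding N by (auto dest: subgroup.subset)
  finally have 1: "(\<Sum>K\<in>?S. if N \<subseteq> K then ?\<mu> K else 0)
    = (\<Sum>K | subgroup K G \<and> carrier G \<inter> N \<subseteq> K \<and> K \<subseteq> carrier G \<and> Q K. ?\<mu> K)" .
  have "(\<Sum>K\<in>?S. \<Sum>M | M \<in> complements G H h \<and> K \<subseteq> M. ?\<mu> K)
      = (\<Sum>M\<in>complements G H h. \<Sum>K | K \<in> ?S \<and> K \<subseteq> M. ?\<mu> K)"
    using fin finite_complements by (rule sum.swap_restrict)
  also have "\<dots> = (\<Sum>M\<in>complements G H h. \<Sum>K | subgroup K G \<and> M \<inter> N \<subseteq> K \<and> K \<subseteq> M \<and> Q K. ?\<mu> K)"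
    using complement_kernel_subset by (intro sum.cong refl) auto
  finally show ?thesis using 1 by (simp add: lifted_moebius_def sum_subtractf)
qed

lemma moebius_eq_lifted_moebius:
  assumes "subgroup K G"
  shows "moebius G (disc G) K = lifted_moebius K"
proof (rule moebius_discrete_unique[OF G.group_axioms finite_carrier _ assms])
  fix K assume K: "subgroup K G"
  have KG: "K \<subseteq> carrier G" using K by (rule subgroup.subset)
  \<comment> \<open>Pushed forward to \<open>H\<close>, the sum becomes the defining sum of the
    Moebius function of \<open>H\<close> at the image of \<open>K\<close>. This covers
    \<open>carrier G\<close> and every complement.\<close>
  have aux: "(\<Sum>L | subgroup L G \<and> M \<inter> N \<subseteq> L \<and> L \<subseteq> M \<and> K \<subseteq> L. moebius H (disc H) (h ` L))
      = (if K \<subseteq> M \<and> h ` K = carrier H then 1 else 0)" if M: "subgroup M G" "h ` M = carrier H" for M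
  proof (cases "K \<subseteq> M")
    case True
    have "K \<subseteq> L \<longleftrightarrow> h ` K \<subseteq> h ` L" if L: "subgroup L G" "M \<inter> N \<subseteq> L" "L \<subseteq> M" for L
      using vimage_Int_image[OF M(1) L] True by blast
    then have "(\<Sum>L | subgroup L G \<and> M \<inter> N \<subseteq> L \<and> L \<subseteq> M \<and> K \<subseteq> L. moebius H (disc H) (h ` L))
      = (\<Sum>L | subgroup L H \<and> h ` K \<subseteq> L. moebius H (disc H) L)"
      by (intro sum_subgroups_image M)
    then show ?thesis
      using sum_moebius_discrete[OF H.group_axioms finite_image, of "h ` K"] K True
      by (simp add: subgroup_img_is_subgroup)
  next
    case False
    then have empty: "{L. subgroup L G \<and> M \<inter> N \<subseteq> L \<and> L \<subseteq> M \<and> K \<subseteq> L} = {}" by auto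
    show ?thesis unfolding empty using False by simp
  qed
  have "(\<Sum>L | subgroup L G \<and> K \<subseteq> L. lifted_moebius L)
      = (if h ` K = carrier H then 1 else 0)
        - (\<Sum>M\<in>complements G H h. if K \<subseteq> M \<and> h ` K = carrier H then 1 else 0)"
    unfolding sum_lifted_moebius using aux[OF G.subgroup_self surj] aux KG
    by (auto simp: complements_def intro!: sum.cong)
  also have "\<dots> = (if K = carrier G then 1 else 0)"
  proof (cases "h ` K = carrier H \<and> K \<noteq> carrier G")
    case True
    then have Kc: "K \<in> complements G H h" using K by (simp add: complements_def)
    \<comment> \<open>All complements have order \<open>card (carrier H)\<close>, so inclusion
      between two of them is equality; only \<open>M = K\<close> contributes and cancels the leading
      \<open>1\<close>.\<close>
    have "K \<subseteq> M \<longleftrightarrow> M = K" if M: "M \<in> complements G H h" for M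
    proof -
      have "M \<subseteq> carrier G" using M by (auto simp: complements_def dest: subgroup.subset)
      then have "finite M" using finite_carrier by (rule finite_subset)
      then show ?thesis
        using card_complement[OF M] card_complement[OF Kc] card_subset_eq[of M K] by auto
    qed
    then have "(\<Sum>M\<in>complements G H h. if K \<subseteq> M \<and> h ` K = carrier H then 1 else (0::int))
        = (\<Sum>M\<in>complements G H h. if M = K then 1 else 0)"
      using True by (intro sum.cong) auto
    then show ?thesis using True Kc finite_complements by simp
  next
    case False
    then consider "K = carrier G" | "h ` K \<noteq> carrier H" by blast
    then show ?thesis
    proof cases
      case 1
      have "\<not> carrier G \<subseteq> M" if "M \<in> complements G H h" for M
        using that by (auto simp: complements_def dest: subgroup.subset)
      then show ?thesis using 1 surj by (simp add: sum.neutral)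
    next
      case 2
      then show ?thesis using surj by auto
    qed
  qed
  finally show "(\<Sum>L | subgroup L G \<and> K \<subseteq> L. lifted_moebius L) = (if K = carrier G then 1 else 0)" .
qed

text \<open>In \<open>lifted_moebius\<close>, a subgroup containing the kernel has the same index as
  its image in \<open>H\<close>. A subgroup of a complement maps injectively, so its index in
  \<open>G\<close> is \<open>card N\<close> times that of its image; this produces the
  shift.\<close>

theorem P_coeff_prime_kernel:
  assumes "n \<ge> 1"
  shows "P_coeff G (disc G) n = P_coeff H (disc H) n
           - int (card (complements G H h)) * dirichlet_shift (card N) (P_coeff H (disc H)) n"
proof -
  let ?\<mu> = "moebius H (disc H)" and ?p = "card N"
  have p: "?p > 0" using prime_card_kernel by (rule prime_gt_0_nat)
  have cardH: "card (carrier H) > 0" using finite_image by (auto simp: card_gt_0_iff)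
  have cK: "card K = card (M \<inter> N) * card (h ` K)"
    if K: "subgroup K G" "M \<inter> N \<subseteq> K" "K \<subseteq> M" for K M
  proof -
    have "finite K" using subgroup.subset[OF K(1)] finite_carrier by (rule finite_subset)
    moreover have "M \<inter> N = K \<inter> N" using K by auto
    ultimately show ?thesis using K(1) by (intro card_eq_card_image)
  qed
  have "P_coeff G (disc G) n = (\<Sum>K | subgroup K G \<and> n * card K = card (carrier G). lifted_moebius K)"
    unfolding P_coeff_discrete[OF G.group_axioms finite_carrier]
    by (intro sum.cong) (auto simp: moebius_eq_lifted_moebius)
  also have "\<dots> = (\<Sum>L | subgroup L H \<and> n * card L = card (carrier H). ?\<mu> L)
      - (\<Sum>M\<in>complements G H h. \<Sum>L | subgroup L H \<and> n * card L = ?p * card (carrier H). ?\<mu> L)"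
    unfolding sum_lifted_moebius
  proof (intro arg_cong2[of _ _ _ _ "(-)"] sum.cong refl)
    have "n * card K = card (carrier G) \<longleftrightarrow> n * card (h ` K) = card (carrier H)"
      if "subgroup K G" "carrier G \<inter> N \<subseteq> K" "K \<subseteq> carrier G" for K
    proof -
      have "carrier G \<inter> N = N" by (auto simp: kernel_def)
      then have "card K = ?p * card (h ` K)" using cK[OF that] by simp
      then show ?thesis using p by (simp add: card_carrier mult.left_commute[of n])
    qed
    then show "(\<Sum>K | subgroup K G \<and> carrier G \<inter> N \<subseteq> K \<and> K \<subseteq> carrier G \<and> n * card K = card (carrier G). ?\<mu> (h ` K))
      = (\<Sum>L | subgroup L H \<and> n * card L = card (carrier H). ?\<mu> L)"
      by (intro sum_subgroups_image G.subgroup_self surj)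
  next
    fix M assume M: "M \<in> complements G H h"
    then have "n * card K = card (carrier G) \<longleftrightarrow> n * card (h ` K) = ?p * card (carrier H)"
      if "subgroup K G" "M \<inter> N \<subseteq> K" "K \<subseteq> M" for K
      using cK[OF that] complement_Int_kernel[OF M] by (simp add: card_carrier)
    then show "(\<Sum>K | subgroup K G \<and> M \<inter> N \<subseteq> K \<and> K \<subseteq> M \<and> n * card K = card (carrier G). ?\<mu> (h ` K))
      = (\<Sum>L | subgroup L H \<and> n * card L = ?p * card (carrier H). ?\<mu> L)"
      using M by (intro sum_subgroups_image) (auto simp: complements_def)
  qed
  also have "(\<Sum>L | subgroup L H \<and> n * card L = ?p * card (carrier H). ?\<mu> L)
      = dirichlet_shift ?p (P_coeff H (disc H)) n"
  proof (cases "?p dvd n")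
    case True
    then show ?thesis using p
      by (auto simp: dirichlet_shift_def P_coeff_discrete[OF H.group_axioms finite_image] mult.assoc)
  next
    case False
    \<comment> \<open>Such an \<open>L\<close> would give \<open>n = ?p * k\<close>, with
      \<open>k\<close> the index of \<open>L\<close> in \<open>H\<close>.\<close>
    have empty: "{L. subgroup L H \<and> n * card L = ?p * card (carrier H)} = {}"
    proof safe
      fix L assume L: "subgroup L H" "n * card L = ?p * card (carrier H)"
      have "card L dvd card (carrier H)"
        using L(1) finite_image by (intro H.subgroup_card_dvd H.subgroup_self subgroup.subset) auto
      then obtain k where k: "card (carrier H) = card L * k" by blast
      then have "n * card L = (?p * k) * card L" using L(2) by (simp only: mult_ac)
      moreover have "card L \<noteq> 0" using k cardH by (metis mult_zero_left nless_le)
      ultimately have "n = ?p * k" by (metis mult_right_cancel)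
      then show "L \<in> {}" using False by simp
    qed
    show ?thesis unfolding empty using False by (simp add: dirichlet_shift_def)
  qed
  finally show ?thesis by (simp add: P_coeff_discrete[OF H.group_axioms finite_image])
qed

corollary prob_zeta_coeff_prime_kernel:
  assumes "n \<ge> 1"
  shows "prob_zeta_coeff G (disc G) n
       = euler_factor_div (card N) (int (card (complements G H h))) (prob_zeta_coeff H (disc H)) n"
proof -
  have "P_coeff H (disc H) 1 = 1" using topological_group_discrete[OF H.group_axioms] by (rule P_coeff_1)
  then show ?thesis unfolding prob_zeta_coeff_def
    using assms prime_gt_1_nat[OF prime_card_kernel] P_coeff_prime_kernel
    by (intro dirichlet_inverse_mult_euler_factor) auto
qed

end


section \<open>Finite groups as profinite groups\<close>

text \<open>The group is the limit of a constant system over a one-point index set. Singletons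
  \<open>{x}\<close> replace the elements because the members of the system must live on the type
  \<open>'a set\<close>.\<close>

lemma finite_group_profinite:
  fixes G :: "'a monoid" (structure)
  assumes "group G" and fin: "finite (carrier G)"
  shows "profinite_group G (disc G)"
proof -
  interpret group G by fact
  define F :: "'a set \<Rightarrow> 'a set monoid" where
    "F = (\<lambda>_. \<lparr>carrier = (\<lambda>x. {x}) ` carrier G, mult = (\<lambda>X Y. {the_elem X \<otimes> the_elem Y}), one = {\<one>}\<rparr>)"
  define I :: "'a set set" where "I = {{}}"
  define r :: "'a set rel" where "r = {({}, {})}"
  define \<phi> :: "'a set \<Rightarrow> 'a set \<Rightarrow> 'a set \<Rightarrow> 'a set" where "\<phi> = (\<lambda>_ _ X. X)"
  define h :: "'a \<Rightarrow> 'a set \<Rightarrow> 'a set" where "h = (\<lambda>x. \<lambda>i\<in>I. {x})"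
  have "group (F i)" for i
    unfolding F_def by (rule groupI) (auto simp: m_assoc intro: l_inv_ex)
  then have "inverse_system I r F \<phi>"
    by (auto simp: inverse_system_def I_def r_def \<phi>_def hom_def partial_order_on_def preorder_on_def
        refl_on_def trans_def antisym_def monoid.m_closed group.is_monoid)
  moreover have "\<forall>i\<in>I. finite (carrier (F i))" using fin by (simp add: F_def)
  moreover have "topological_group_isomorphic G (disc G)
      (inverse_limit_group I r F \<phi>) (inverse_limit_topology I r F \<phi>)"
  proof -
    have car: "inverse_limit_carrier I r F \<phi> = h ` carrier G"
    proof (intro equalityI subsetI)
      fix x assume "x \<in> inverse_limit_carrier I r F \<phi>"
      then have x: "x {} \<in> (\<lambda>y. {y}) ` carrier G" "x \<in> extensional I"
        by (auto simp: inverse_limit_carrier_def I_def F_def PiE_iff)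
      then obtain y where y: "y \<in> carrier G" "x {} = {y}" by auto
      have "x = h y" by (rule extensionalityI[of _ I]) (use x y in \<open>auto simp: h_def I_def\<close>)
      then show "x \<in> h ` carrier G" using y(1) by simp
    next
      fix x assume "x \<in> h ` carrier G"
      then have "x \<in> (\<Pi>\<^sub>E i\<in>I. carrier (F i))"
        by (auto simp: h_def F_def intro!: restrict_PiE_iff[THEN iffD2] simp del: restrict_apply)
      then show "x \<in> inverse_limit_carrier I r F \<phi>"
        by (simp add: inverse_limit_carrier_def r_def \<phi>_def)
    qed
    have inj: "inj_on h (carrier G)"
      by (auto simp: inj_on_def h_def I_def fun_eq_iff)
    have "h \<in> iso G (inverse_limit_group I r F \<phi>)"
      unfolding iso_def hom_def bij_betw_def inverse_limit_group_def mem_Collect_eq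
    proof (intro conjI ballI inj)
      fix x y assume "x \<in> carrier G" "y \<in> carrier G"
      show "h (x \<otimes> y) = h x \<otimes>\<^bsub>product_group I F\<lparr>carrier := inverse_limit_carrier I r F \<phi>\<rparr>\<^esub> h y"
        by (rule extensionalityI[of _ I]) (simp_all add: h_def F_def)
    qed (simp_all add: car)
    moreover have "homeomorphic_map (disc G) (inverse_limit_topology I r F \<phi>) h"
    \<comment> \<open>A continuous bijection from a compact space, here finite and discrete, to a
      Hausdorff space is a homeomorphism.\<close>
    proof (rule continuous_imp_homeomorphic_map)
      have "h ` carrier G \<subseteq> (\<Pi>\<^sub>E i\<in>I. carrier (F i))"
        unfolding car[symmetric] inverse_limit_carrier_def by blast
      then show img: "h ` topspace (disc G) = topspace (inverse_limit_topology I r F \<phi>)"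
        by (simp add: inverse_limit_topology_def car Int_absorb1)
      show "continuous_map (disc G) (inverse_limit_topology I r F \<phi>) h"
        using img by (simp add: Pi_iff image_subset_iff[symmetric])
      show "Hausdorff_space (inverse_limit_topology I r F \<phi>)"
        unfolding inverse_limit_topology_def
        by (intro Hausdorff_space_subtopology) (simp add: Hausdorff_space_product_topology)
    qed (use fin inj in \<open>auto simp: compact_space_discrete_topology\<close>)
    ultimately show ?thesis by (auto simp: topological_group_isomorphic_def)
  qed
  ultimately have "inverse_limit_of_finite (\<lambda>_. True) G (disc G)"
    unfolding inverse_limit_of_finite_def by blast
  then show ?thesis using topological_group_discrete[OF assms(1)] by (simp add: profinite_group_def)
qed

lemma finite_group_topologically_finitely_generated:
  assumes "group G" "finite (carrier G)"
  shows "topologically_finitely_generated G (disc G)"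
proof -
  interpret group G by fact
  have "generate G (carrier G) = carrier G"
    using generate_incl[of "carrier G"] by (auto intro: generate.incl)
  then show ?thesis unfolding topologically_finitely_generated_def
    using assms(2) by (intro exI[of _ "carrier G"]) (simp add: discrete_topology_closure_of)
qed

section \<open>Solubility of finite prosoluble groups\<close>

lemma (in group) derived_power_antimono:
  assumes "m \<le> n"
  shows "(derived G ^^ n) (carrier G) \<subseteq> (derived G ^^ m) (carrier G)"
proof (rule lift_Suc_antimono_le[OF _ assms])
  fix n
  have "subgroup ((derived G ^^ n) (carrier G)) G"
    by (intro exp_of_derived_is_subgroup subgroup_self)
  then show "(derived G ^^ Suc n) (carrier G) \<subseteq> (derived G ^^ n) (carrier G)"
    by (simp add: derived_incl)
qed

text \<open>The derived series of \<open>G\<close> maps into that of \<open>F\<close>, so every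
  \<open>x \<noteq> \<one>\<close> drops out of it at some stage; a maximum over the finite group
  works for all \<open>x\<close> at once.\<close>

lemma (in group) finite_residually_solvable:
  assumes fin: "finite (carrier G)"
    and sep: "\<And>x. x \<in> carrier G \<Longrightarrow> x \<noteq> \<one>
      \<Longrightarrow> \<exists>(F :: 'c monoid) f. group_hom G F f \<and> solvable F \<and> f x \<noteq> \<one>\<^bsub>F\<^esub>"
  shows "solvable G"
proof -
  let ?D = "\<lambda>n. (derived G ^^ n) (carrier G)"
  have "\<exists>n. x \<notin> ?D n" if x: "x \<in> carrier G" "x \<noteq> \<one>" for x
  proof -
    obtain F :: "'c monoid" and f where F: "group_hom G F f" "solvable F" "f x \<noteq> \<one>\<^bsub>F\<^esub>"
      using sep[OF x] by blast
    interpret group_hom G F f by fact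
    obtain n where n: "(derived F ^^ n) (carrier F) = {\<one>\<^bsub>F\<^esub>}"
      using F(2) H.solvable_iff_trivial_derived_seq by blast
    have "f ` ?D n = (derived F ^^ n) (f ` carrier G)" by (rule exp_of_derived_img[symmetric]) simp
    also have "\<dots> \<subseteq> (derived F ^^ n) (carrier F)" by (rule H.mono_exp_of_derived) auto
    finally show ?thesis using n F(3) by auto
  qed
  then obtain k where k: "x \<notin> ?D (k x)" if "x \<in> carrier G" "x \<noteq> \<one>" for x by metis
  let ?n = "Max (insert 0 (k ` carrier G))"
  have "x \<notin> ?D ?n" if x: "x \<in> carrier G" "x \<noteq> \<one>" for x
  proof -
    have "k x \<le> ?n" using fin x by (intro Max_ge) auto
    then show ?thesis using k[OF x] derived_power_antimono by blast
  qed
  moreover have D: "subgroup (?D ?n) G" by (intro exp_of_derived_is_subgroup subgroup_self)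
  ultimately have "?D ?n = {\<one>}"
    using subgroup.mem_carrier[OF D] subgroup.one_closed[OF D] by blast
  then show ?thesis using solvable_iff_trivial_derived_seq by blast
qed

text \<open>The coordinate projections of the inverse limit are homomorphisms to soluble groups, and
  they separate the points of \<open>G\<close>.\<close>

lemma finite_prosoluble_imp_solvable:
  fixes G :: "'a monoid" (structure)
  assumes "group G" "finite (carrier G)" "prosoluble_group G T"
  shows "solvable G"
proof -
  interpret group G by fact
  obtain I :: "'a set set" and r and F :: "'a set \<Rightarrow> 'a set monoid" and \<phi> and h where
    sys: "inverse_system I r F \<phi>" and solv: "\<And>i. i \<in> I \<Longrightarrow> solvable (F i)"
    and h: "h \<in> iso G (inverse_limit_group I r F \<phi>)"
    using assms(3) unfolding prosoluble_group_def inverse_limit_of_finite_def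
      topological_group_isomorphic_def by blast
  have grp: "group (F i)" if "i \<in> I" for i using sys that by (simp add: inverse_system_def)
  have hin: "h x \<in> (\<Pi>\<^sub>E i\<in>I. carrier (F i))" if "x \<in> carrier G" for x
    using h that by (auto simp: iso_def hom_def inverse_limit_group_def inverse_limit_carrier_def Pi_iff)
  have hm: "h (x \<otimes> y) = (\<lambda>i\<in>I. h x i \<otimes>\<^bsub>F i\<^esub> h y i)" if "x \<in> carrier G" "y \<in> carrier G" for x y
    using h that by (auto simp: iso_def hom_def inverse_limit_group_def)
  have gh: "group_hom G (F i) (\<lambda>x. h x i)" if i: "i \<in> I" for i
    using grp[OF i] hin hm i
    by (intro group_hom.intro is_group) (auto simp: group_hom_axioms_def hom_def PiE_iff)
  show ?thesis
  proof (rule finite_residually_solvable[OF assms(2)])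
    fix x assume x: "x \<in> carrier G" "x \<noteq> \<one>"
    have "inj_on h (carrier G)" using h by (simp add: iso_def bij_betw_def)
    then have "h x \<noteq> h \<one>" using x by (auto dest: inj_onD)
    then obtain i where i: "i \<in> I" "h x i \<noteq> h \<one> i" using hin x by (metis PiE_ext one_closed)
    have "h \<one> i = \<one>\<^bsub>F i\<^esub>" using group_hom.hom_one[OF gh[OF i(1)]] .
    then show "\<exists>(F :: 'a set monoid) f. group_hom G F f \<and> solvable F \<and> f x \<noteq> \<one>\<^bsub>F\<^esub>"
      using gh[OF i(1)] solv[OF i(1)] i(2) by metis
  qed
qed


section \<open>Direct products with cyclic groups\<close>

text \<open>The direct product of the cyclic group of order \<open>p\<close> with \<open>B\<close>, where the pair \<open>(j, f)\<close> is
  encoded as the sequence \<open>j, f 0, f 1, \<dots>\<close>.\<close>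

definition adjoin_cyclic :: "nat \<Rightarrow> (nat \<Rightarrow> nat) monoid \<Rightarrow> (nat \<Rightarrow> nat) monoid" where
  "adjoin_cyclic p B =
     \<lparr>carrier = {g. g 0 < p \<and> g \<circ> Suc \<in> carrier B},
      mult = (\<lambda>g k. case_nat ((g 0 + k 0) mod p) ((g \<circ> Suc) \<otimes>\<^bsub>B\<^esub> (k \<circ> Suc))),
      one = case_nat 0 \<one>\<^bsub>B\<^esub>\<rparr>"

text \<open>Homomorphisms to the additive group of residues modulo \<open>p\<close>. Extensionality
  makes each of them a single function, so that they can be counted.\<close>

definition cyclic_homs :: "nat \<Rightarrow> 'a monoid \<Rightarrow> ('a \<Rightarrow> nat) set" where
  "cyclic_homs p B =
     {\<theta> \<in> carrier B \<rightarrow>\<^sub>E {..<p}. \<forall>x\<in>carrier B. \<forall>y\<in>carrier B. \<theta> (x \<otimes>\<^bsub>B\<^esub> y) = (\<theta> x + \<theta> y) mod p}"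

lemma case_nat_comp_Suc [simp]: "case_nat j f \<circ> Suc = f"
  by auto

lemma case_nat_collapse [simp]: "case_nat (g 0) (g \<circ> Suc) = g"
  by (auto split: nat.split)

lemma adjoin_cyclic_simps [simp]:
  "g \<in> carrier (adjoin_cyclic p B) \<longleftrightarrow> g 0 < p \<and> g \<circ> Suc \<in> carrier B"
  "g \<otimes>\<^bsub>adjoin_cyclic p B\<^esub> k = case_nat ((g 0 + k 0) mod p) ((g \<circ> Suc) \<otimes>\<^bsub>B\<^esub> (k \<circ> Suc))"
  "\<one>\<^bsub>adjoin_cyclic p B\<^esub> = case_nat 0 \<one>\<^bsub>B\<^esub>"
  by (simp_all add: adjoin_cyclic_def)

lemma group_adjoin_cyclic:
  fixes B :: "(nat \<Rightarrow> nat) monoid" (structure)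
  assumes "group B" "p > 0"
  shows "group (adjoin_cyclic p B)"
proof -
  interpret group B by fact
  show ?thesis
  proof (rule groupI)
    fix g assume g: "g \<in> carrier (adjoin_cyclic p B)"
    \<comment> \<open>Reducing \<open>p - g 0\<close> modulo \<open>p\<close> matters for
      \<open>g 0 = 0\<close>, where the difference is \<open>p\<close> itself and not a
      residue.\<close>
    have "((p - g 0) mod p + g 0) mod p = 0" using g by (simp add: mod_add_left_eq)
    then show "\<exists>k\<in>carrier (adjoin_cyclic p B). k \<otimes>\<^bsub>adjoin_cyclic p B\<^esub> g = \<one>\<^bsub>adjoin_cyclic p B\<^esub>"
      using g assms(2) by (intro bexI[of _ "case_nat ((p - g 0) mod p) (inv (g \<circ> Suc))"]) auto
  next
    fix g assume g: "g \<in> carrier (adjoin_cyclic p B)"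
    then have "case_nat (g 0 mod p) (g \<circ> Suc) = g" by simp
    then show "\<one>\<^bsub>adjoin_cyclic p B\<^esub> \<otimes>\<^bsub>adjoin_cyclic p B\<^esub> g = g" using g by simp
  qed (use assms(2) in \<open>auto simp: m_assoc mod_simps add.assoc\<close>)
qed

lemma finite_adjoin_cyclic:
  assumes "finite (carrier B)"
  shows "finite (carrier (adjoin_cyclic p B))"
proof (rule finite_subset)
  show "carrier (adjoin_cyclic p B) \<subseteq> (\<lambda>(j, f). case_nat j f) ` ({..<p} \<times> carrier B)"
  proof
    fix g assume "g \<in> carrier (adjoin_cyclic p B)"
    then show "g \<in> (\<lambda>(j, f). case_nat j f) ` ({..<p} \<times> carrier B)"
      by (intro image_eqI[of _ _ "(g 0, g \<circ> Suc)"]) auto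
  qed
qed (use assms in auto)

lemma group_hom_adjoin_cyclic:
  assumes "group B" "p > 0"
  shows "group_hom (adjoin_cyclic p B) B (\<lambda>g. g \<circ> Suc)"
  using assms group_adjoin_cyclic
  by (auto simp: group_hom_def group_hom_axioms_def hom_def)

lemma surj_adjoin_cyclic:
  assumes "p > 0"
  shows "(\<lambda>g. g \<circ> Suc) ` carrier (adjoin_cyclic p B) = carrier B"
proof (intro equalityI subsetI)
  fix f assume "f \<in> carrier B"
  then show "f \<in> (\<lambda>g. g \<circ> Suc) ` carrier (adjoin_cyclic p B)"
    using assms by (intro image_eqI[of _ _ "case_nat 0 f"]) auto
qed auto

lemma card_kernel_adjoin_cyclic:
  fixes B :: "(nat \<Rightarrow> nat) monoid" (structure)
  assumes "group B"
  shows "card (kernel (adjoin_cyclic p B) B (\<lambda>g. g \<circ> Suc)) = p"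
proof -
  interpret group B by fact
  have "bij_betw (\<lambda>j. case_nat j \<one>\<^bsub>B\<^esub>) {..<p} (kernel (adjoin_cyclic p B) B (\<lambda>g. g \<circ> Suc))"
    by (rule bij_betw_byWitness[where f' = "\<lambda>g. g 0"]) (auto simp: kernel_def, metis case_nat_collapse)
  then show ?thesis by (simp add: bij_betw_same_card[symmetric])
qed

lemma prime_kernel_hom_adjoin_cyclic:
  assumes "group B" "finite (carrier B)" "prime p"
  shows "prime_kernel_hom (adjoin_cyclic p B) B (\<lambda>g. g \<circ> Suc)"
  using assms prime_gt_0_nat[OF assms(3)]
  by (intro prime_kernel_hom.intro prime_kernel_hom_axioms.intro group_hom_adjoin_cyclic)
     (simp_all add: finite_adjoin_cyclic surj_adjoin_cyclic card_kernel_adjoin_cyclic)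

section \<open>Counting homomorphisms to cyclic groups\<close>

lemma finite_cyclic_homs: "finite (carrier B) \<Longrightarrow> finite (cyclic_homs p B)"
  unfolding cyclic_homs_def by (rule finite_subset[of _ "carrier B \<rightarrow>\<^sub>E {..<p}"]) (auto intro: finite_PiE)

lemma cyclic_homs_less: "\<theta> \<in> cyclic_homs p B \<Longrightarrow> x \<in> carrier B \<Longrightarrow> \<theta> x < p"
  by (auto simp: cyclic_homs_def PiE_iff)

lemma cyclic_homs_mult:
  "\<theta> \<in> cyclic_homs p B \<Longrightarrow> x \<in> carrier B \<Longrightarrow> y \<in> carrier B \<Longrightarrow> \<theta> (x \<otimes>\<^bsub>B\<^esub> y) = (\<theta> x + \<theta> y) mod p"
  by (auto simp: cyclic_homs_def)

lemma cyclic_homs_one: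
  assumes "group B" "\<theta> \<in> cyclic_homs p B"
  shows "\<theta> \<one>\<^bsub>B\<^esub> = 0"
proof -
  interpret group B by fact
  have "\<theta> \<one>\<^bsub>B\<^esub> = (\<theta> \<one>\<^bsub>B\<^esub> + \<theta> \<one>\<^bsub>B\<^esub>) mod p" "\<theta> \<one>\<^bsub>B\<^esub> < p"
    using cyclic_homs_mult[OF assms(2), of "\<one>\<^bsub>B\<^esub>" "\<one>\<^bsub>B\<^esub>"] cyclic_homs_less[OF assms(2)] by auto
  then show ?thesis by (auto simp: mod_if split: if_splits)
qed

lemma cyclic_homs_inv:
  assumes "group B" "\<theta> \<in> cyclic_homs p B" "x \<in> carrier B"
  shows "\<theta> (inv\<^bsub>B\<^esub> x) = (p - \<theta> x) mod p"
proof -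
  interpret group B by fact
  have "(\<theta> (inv\<^bsub>B\<^esub> x) + \<theta> x) mod p = 0" "\<theta> (inv\<^bsub>B\<^esub> x) < p" "\<theta> x < p"
    using cyclic_homs_mult[OF assms(2), of "inv\<^bsub>B\<^esub> x" x] cyclic_homs_one[OF assms(1,2)]
      cyclic_homs_less[OF assms(2)] assms(3) by auto
  then show ?thesis by (auto simp: mod_if split: if_splits)
qed

lemma card_cyclic_homs_pos:
  assumes "group B" "finite (carrier B)" "p > 0"
  shows "card (cyclic_homs p B) \<ge> 1"
proof -
  interpret group B by fact
  have "(\<lambda>x\<in>carrier B. 0) \<in> cyclic_homs p B" using assms(3) by (auto simp: cyclic_homs_def)
  then show ?thesis using finite_cyclic_homs[OF assms(2), of p]
    by (metis One_nat_def Suc_leI card_gt_0_iff empty_iff)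
qed

text \<open>The graph of a homomorphism to the cyclic factor is a complement of that factor in the
  direct product, and it determines the homomorphism.\<close>

lemma card_cyclic_homs_le_complements:
  fixes B :: "(nat \<Rightarrow> nat) monoid" (structure)
  assumes "group B" "finite (carrier B)" "p > 1"
  shows "card (cyclic_homs p B) \<le> card (complements (adjoin_cyclic p B) B (\<lambda>g. g \<circ> Suc))"
proof (rule card_inj_on_le)
  interpret group B by fact
  let ?G = "adjoin_cyclic p B"
  define graph where "graph \<theta> = {g \<in> carrier ?G. g 0 = \<theta> (g \<circ> Suc)}" for \<theta> :: "(nat \<Rightarrow> nat) \<Rightarrow> nat"
  interpret G: group ?G using assms by (intro group_adjoin_cyclic) auto
  have inv0: "(inv\<^bsub>?G\<^esub> g) = case_nat ((p - g 0) mod p) (inv (g \<circ> Suc))" if "g \<in> carrier ?G" for g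
  proof (rule G.inv_equality)
    show "case_nat ((p - g 0) mod p) (inv (g \<circ> Suc)) \<otimes>\<^bsub>?G\<^esub> g = \<one>\<^bsub>?G\<^esub>"
      using that by (simp add: mod_add_left_eq)
  qed (use that assms(3) in auto)
  show "inj_on graph (cyclic_homs p B)"
  proof (rule inj_onI)
    fix \<theta> \<psi> assume \<theta>: "\<theta> \<in> cyclic_homs p B" and \<psi>: "\<psi> \<in> cyclic_homs p B" and eq: "graph \<theta> = graph \<psi>"
    show "\<theta> = \<psi>"
    proof (rule extensionalityI[of _ "carrier B"])
      fix x assume x: "x \<in> carrier B"
      then have "case_nat (\<theta> x) x \<in> graph \<theta>" using cyclic_homs_less[OF \<theta>] by (simp add: graph_def)
      then have "case_nat (\<theta> x) x \<in> graph \<psi>" using eq by simp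
      then show "\<theta> x = \<psi> x" by (simp add: graph_def)
    qed (use \<theta> \<psi> in \<open>auto simp: cyclic_homs_def PiE_iff\<close>)
  qed
  show "graph ` cyclic_homs p B \<subseteq> complements ?G B (\<lambda>g. g \<circ> Suc)"
  proof
    fix M assume "M \<in> graph ` cyclic_homs p B"
    then obtain \<theta> where \<theta>: "\<theta> \<in> cyclic_homs p B" and M: "M = graph \<theta>" by auto
    have "subgroup M ?G"
      unfolding M graph_def
      by (rule G.subgroupI)
         (use assms(3) cyclic_homs_one[OF assms(1) \<theta>] cyclic_homs_mult[OF \<theta>] cyclic_homs_inv[OF assms(1) \<theta>]
           in \<open>auto simp: inv0 intro: exI[of _ "case_nat 0 \<one>"]\<close>)
    moreover have "(\<lambda>g. g \<circ> Suc) ` M = carrier B"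
    proof (intro equalityI subsetI)
      fix x assume "x \<in> carrier B"
      then show "x \<in> (\<lambda>g. g \<circ> Suc) ` M"
        using cyclic_homs_less[OF \<theta>] by (intro image_eqI[of _ _ "case_nat (\<theta> x) x"]) (auto simp: M graph_def)
    qed (auto simp: M graph_def)
    \<comment> \<open>This element lies in the kernel of the projection but off the graph, so
      \<open>M\<close> is proper.\<close>
    moreover have "case_nat 1 \<one> \<in> carrier ?G - M"
      using assms(3) cyclic_homs_one[OF assms(1) \<theta>] by (auto simp: M graph_def)
    ultimately show "M \<in> complements ?G B (\<lambda>g. g \<circ> Suc)" by (auto simp: complements_def)
  qed
  show "finite (complements ?G B (\<lambda>g. g \<circ> Suc))"
    unfolding complements_def by (intro finite_subgroups finite_adjoin_cyclic assms(2))
qed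

text \<open>A pair \<open>(j, \<theta>)\<close> yields the homomorphism sending
  \<open>(i, x)\<close> to \<open>\<theta> x + j * i\<close>. The residue \<open>j\<close> is read
  off at the generator of the cyclic factor, and \<open>\<theta>\<close> on the factor
  \<open>B\<close>.\<close>

lemma card_cyclic_homs_adjoin_cyclic:
  fixes B :: "(nat \<Rightarrow> nat) monoid" (structure)
  assumes "group B" "finite (carrier B)" "p > 1"
  shows "p * card (cyclic_homs p B) \<le> card (cyclic_homs p (adjoin_cyclic p B))"
proof -
  interpret group B by fact
  let ?G = "adjoin_cyclic p B"
  define \<Phi> where "\<Phi> = (\<lambda>(j, \<theta>). \<lambda>g\<in>carrier ?G. (\<theta> (g \<circ> Suc) + j * g 0) mod p)"
  have closed: "case_nat ((g 0 + k 0) mod p) ((g \<circ> Suc) \<otimes> (k \<circ> Suc)) \<in> carrier ?G"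
    if "g \<in> carrier ?G" "k \<in> carrier ?G" for g k
    using that assms(3) by simp
  have "card ({..<p} \<times> cyclic_homs p B) \<le> card (cyclic_homs p ?G)"
  proof (rule card_inj_on_le)
    show "inj_on \<Phi> ({..<p} \<times> cyclic_homs p B)"
    proof (rule inj_onI, safe)
      fix j \<theta> k \<psi>
      assume j: "j < p" and \<theta>: "\<theta> \<in> cyclic_homs p B" and k: "k < p" and \<psi>: "\<psi> \<in> cyclic_homs p B"
        and eq: "\<Phi> (j, \<theta>) = \<Phi> (k, \<psi>)"
      have "\<Phi> (j, \<theta>) (case_nat 1 \<one>) = \<Phi> (k, \<psi>) (case_nat 1 \<one>)" using eq by simp
      then show "j = k"
        using j k assms(3) cyclic_homs_one[OF assms(1) \<theta>] cyclic_homs_one[OF assms(1) \<psi>]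
        by (simp add: \<Phi>_def)
      show "\<theta> = \<psi>"
      proof (rule extensionalityI[of _ "carrier B"])
        fix x assume x: "x \<in> carrier B"
        have "\<Phi> (j, \<theta>) (case_nat 0 x) = \<Phi> (k, \<psi>) (case_nat 0 x)" using eq by simp
        then show "\<theta> x = \<psi> x"
          using x assms(3) cyclic_homs_less[OF \<theta> x] cyclic_homs_less[OF \<psi> x] by (simp add: \<Phi>_def)
      qed (use \<theta> \<psi> in \<open>auto simp: cyclic_homs_def PiE_iff\<close>)
    qed
    show "\<Phi> ` ({..<p} \<times> cyclic_homs p B) \<subseteq> cyclic_homs p ?G"
    proof safe
      fix j \<theta> assume \<theta>: "\<theta> \<in> cyclic_homs p B"
      have "\<Phi> (j, \<theta>) (g \<otimes>\<^bsub>?G\<^esub> k) = (\<Phi> (j, \<theta>) g + \<Phi> (j, \<theta>) k) mod p"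
        if g: "g \<in> carrier ?G" and k: "k \<in> carrier ?G" for g k
      proof -
        have "\<Phi> (j, \<theta>) (g \<otimes>\<^bsub>?G\<^esub> k)
            = ((\<theta> (g \<circ> Suc) + \<theta> (k \<circ> Suc)) mod p + j * ((g 0 + k 0) mod p)) mod p"
          using closed[OF g k] g k cyclic_homs_mult[OF \<theta>] by (simp add: \<Phi>_def)
        also have "\<dots> = ((\<theta> (g \<circ> Suc) + \<theta> (k \<circ> Suc)) + j * (g 0 + k 0)) mod p"
          by (intro mod_add_cong) (simp_all add: mod_mult_right_eq)
        also have "\<dots> = ((\<theta> (g \<circ> Suc) + j * g 0) + (\<theta> (k \<circ> Suc) + j * k 0)) mod p"
          by (simp add: algebra_simps)
        finally show ?thesis using g k by (simp add: \<Phi>_def mod_add_eq)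
      qed
      moreover have "\<Phi> (j, \<theta>) \<in> carrier ?G \<rightarrow>\<^sub>E {..<p}"
        using assms(3) by (auto simp: \<Phi>_def)
      ultimately show "\<Phi> (j, \<theta>) \<in> cyclic_homs p ?G" by (simp add: cyclic_homs_def)
    qed
    show "finite (cyclic_homs p ?G)" by (intro finite_cyclic_homs finite_adjoin_cyclic assms(2))
  qed
  then show ?thesis by (simp add: card_cartesian_product)
qed

text \<open>\<open>E\<close> are the coefficients of \<open>P\<^sub>S(s) / P\<^sub>B(s)\<close>.\<close>

definition growing_extension ::
  "(nat \<Rightarrow> nat) monoid \<Rightarrow> nat \<Rightarrow> nat set \<Rightarrow> (nat \<Rightarrow> nat) monoid \<Rightarrow> (nat \<Rightarrow> int) \<Rightarrow> bool" where
  "growing_extension S k A B E \<longleftrightarrow>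
     group B \<and> finite (carrier B) \<and> \<not> solvable B \<and>
     (\<forall>n\<ge>1. prob_zeta_coeff B (disc B) n = dirichlet_convolution (prob_zeta_coeff S (disc S)) E n) \<and>
     (\<forall>n\<ge>1. E n \<ge> 0) \<and>
     (\<forall>q\<in>A. prime q \<and> (\<forall>m\<ge>1. E (q * m) \<ge> int q ^ k * E m))"

text \<open>Each adjunction divides \<open>E\<close> by an Euler factor and keeps the growth at the
  primes of \<open>A\<close>; growth at \<open>p\<close> itself is added once \<open>h\<close>
  reaches \<open>p^k\<close>. Insolubility passes up from the quotient \<open>B\<close>.\<close>

lemma growing_extension_adjoin_cyclic:
  fixes B p
  defines "G \<equiv> adjoin_cyclic p B" and "h \<equiv> int (card (complements (adjoin_cyclic p B) B (\<lambda>g. g \<circ> Suc)))"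
  assumes ext: "growing_extension S k A B E" and p: "prime p" "p \<notin> A"
  shows "growing_extension S k A G (euler_factor_div p h E)"
    and "h \<ge> int p ^ k \<Longrightarrow> growing_extension S k (insert p A) G (euler_factor_div p h E)"
proof -
  let ?cS = "prob_zeta_coeff S (disc S)"
  have B: "group B" "finite (carrier B)" "\<not> solvable B"
    and cB: "\<And>n. n \<ge> 1 \<Longrightarrow> prob_zeta_coeff B (disc B) n = dirichlet_convolution ?cS E n"
    and E: "\<And>n. n \<ge> 1 \<Longrightarrow> E n \<ge> 0"
    and A: "\<And>q. q \<in> A \<Longrightarrow> prime q" "\<And>q m. q \<in> A \<Longrightarrow> m \<ge> 1 \<Longrightarrow> E (q * m) \<ge> int q ^ k * E m"
    using ext by (auto simp: growing_extension_def)
  have p1: "p > 1" using p(1) by (rule prime_gt_1_nat)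
  interpret prime_kernel_hom G B "\<lambda>g. g \<circ> Suc"
    unfolding G_def using B p(1) by (intro prime_kernel_hom_adjoin_cyclic)
  have "\<not> solvable G" using B(3) surj_hom_imp_solvable[OF surj] by blast
  moreover have "prob_zeta_coeff G (disc G) n = dirichlet_convolution ?cS (euler_factor_div p h E) n"
    if n: "n \<ge> 1" for n
  proof -
    have "prob_zeta_coeff G (disc G) n = euler_factor_div p h (prob_zeta_coeff B (disc B)) n"
      using prob_zeta_coeff_prime_kernel[OF n] card_kernel_adjoin_cyclic[OF B(1), of p]
      by (simp add: G_def h_def)
    also have "\<dots> = euler_factor_div p h (dirichlet_convolution ?cS E) n"
      using cB n by (rule euler_factor_div_cong)
    finally show ?thesis using n p1 by (simp add: dirichlet_convolution_euler_factor_div)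
  qed
  moreover have "euler_factor_div p h E n \<ge> 0" if "n \<ge> 1" for n
    using E that by (intro euler_factor_div_nonneg) (simp_all add: h_def)
  moreover have "euler_factor_div p h E (q * m) \<ge> int q ^ k * euler_factor_div p h E m"
    if "q \<in> A" "m \<ge> 1" for q m
    using that E p A by (intro euler_factor_div_growth) (auto simp: h_def)
  ultimately show *: "growing_extension S k A G (euler_factor_div p h E)"
    using A(1) G.group_axioms finite_carrier by (simp add: growing_extension_def)
  assume "h \<ge> int p ^ k"
  then have "euler_factor_div p h E (p * m) \<ge> int p ^ k * euler_factor_div p h E m" if "m \<ge> 1" for m
    using that E p1 by (intro euler_factor_div_growth_same) auto
  then show "growing_extension S k (insert p A) G (euler_factor_div p h E)"
    using * p(1) by (simp add: growing_extension_def)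
qed

text \<open>Adjoining the cyclic group of order \<open>p\<close> \<open>k\<close> times brings the
  number of homomorphisms to at least \<open>p^k\<close>; one further adjunction then has at least
  that many complements.\<close>

lemma growing_extension_insert:
  assumes ext: "growing_extension S k A B E" and p: "prime p" "p \<notin> A"
  shows "\<exists>G E'. growing_extension S k (insert p A) G E'"
proof -
  have p1: "p > 1" using p(1) by (rule prime_gt_1_nat)
  have "\<exists>G E'. growing_extension S k A G E' \<and> p ^ i \<le> card (cyclic_homs p G)" for i
  proof (induction i)
    case 0
    have "card (cyclic_homs p B) \<ge> 1"
      using ext p1 by (intro card_cyclic_homs_pos) (auto simp: growing_extension_def)
    then show ?case using ext by auto
  next
    case (Suc i)
    then obtain G E' where G: "growing_extension S k A G E'" "p ^ i \<le> card (cyclic_homs p G)" by blast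
    then have "p * card (cyclic_homs p G) \<le> card (cyclic_homs p (adjoin_cyclic p G))"
      using p1 by (intro card_cyclic_homs_adjoin_cyclic) (auto simp: growing_extension_def)
    moreover have "p ^ Suc i \<le> p * card (cyclic_homs p G)" using G(2) by simp
    ultimately show ?case using growing_extension_adjoin_cyclic(1)[OF G(1) p] by (meson order_trans)
  qed
  then obtain G E' where G: "growing_extension S k A G E'" "p ^ k \<le> card (cyclic_homs p G)" by blast
  then have "card (cyclic_homs p G) \<le> card (complements (adjoin_cyclic p G) G (\<lambda>g. g \<circ> Suc))"
    using p1 by (intro card_cyclic_homs_le_complements) (auto simp: growing_extension_def)
  then have "int p ^ k \<le> int (card (complements (adjoin_cyclic p G) G (\<lambda>g. g \<circ> Suc)))"
    using G(2) by (simp flip: of_nat_power)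
  then show ?thesis using growing_extension_adjoin_cyclic(2)[OF G(1) p] by blast
qed

lemma ex_growing_extension:
  assumes S: "group S" "finite (carrier S)" "\<not> solvable S" and "finite A" "\<And>p. p \<in> A \<Longrightarrow> prime p"
  shows "\<exists>G E. growing_extension S k A G E"
  using assms(4,5)
proof (induction A rule: finite_induct)
  case empty
  \<comment> \<open>The induction starts with \<open>S\<close> itself and the unit of convolution as
    \<open>E\<close>.\<close>
  have "dirichlet_convolution c (\<lambda>n. if n = 1 then 1 else 0) n = c n" if "n \<ge> 1" for c n
  proof -
    have "dirichlet_convolution c (\<lambda>n. if n = 1 then 1 else 0) n = (\<Sum>d | d dvd n. if d = n then c d else 0)"
      unfolding dirichlet_convolution_def using that
      by (intro sum.cong) (auto elim!: dvdE)
    also have "\<dots> = c n" using that by simp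
    finally show ?thesis .
  qed
  then have "growing_extension S k {} S (\<lambda>n. if n = 1 then 1 else 0)"
    using S by (simp add: growing_extension_def)
  then show ?case by blast
next
  case (insert p A)
  then show ?case using growing_extension_insert by blast
qed

section \<open>Coefficients of the base group and conclusion\<close>

lemma P_coeff_support:
  assumes "group S" "finite (carrier S)" "P_coeff S (disc S) m \<noteq> 0"
  shows "m dvd card (carrier S)"
proof -
  obtain H where "H \<in> {H. subgroup H S \<and> m * card H = card (carrier S)}"
    using assms(3) unfolding P_coeff_discrete[OF assms(1,2)]
    by (rule sum.not_neutral_contains_not_neutral)
  then have "card (carrier S) = m * card H" by simp
  then show ?thesis by simp
qed

text \<open>Only finitely many coefficients \<open>?a m\<close> are nonzero, so
  \<open>dirichlet_inverse_bound\<close> applies.\<close>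

lemma prob_zeta_coeff_bound:
  assumes "group S" "finite (carrier S)"
  shows "\<exists>t. \<forall>n\<ge>1. \<bar>prob_zeta_coeff S (disc S) n\<bar> \<le> int n ^ t"
proof -
  interpret group S by fact
  let ?N = "card (carrier S)" and ?a = "P_coeff S (disc S)"
  let ?M = "\<Sum>m\<in>{..?N}. \<bar>?a m\<bar>"
  have N: "?N > 0" using assms(2) by (auto simp: card_gt_0_iff)
  have supp: "m dvd ?N" if "?a m \<noteq> 0" for m
    using that P_coeff_support[OF assms] by blast
  have "\<bar>?a m\<bar> \<le> ?M" for m
  proof (cases "?a m = 0")
    case False
    then have "m \<le> ?N" using supp N by (intro dvd_imp_le) auto
    then show ?thesis by (intro member_le_sum) auto
  qed (auto intro: sum_nonneg)
  moreover have "?M \<ge> 0" by (intro sum_nonneg) auto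
  \<comment> \<open>The product \<open>?M * int ?N\<close> itself serves as \<open>t\<close>, as
    \<open>x < 2^x\<close>.\<close>
  moreover have "?M * int ?N \<le> 2 ^ nat (?M * int ?N)"
    using less_exp[of "nat (?M * int ?N)"] 
    by (metis less_imp_le nat_le_iff of_nat_numeral of_nat_power)
  ultimately show ?thesis
    unfolding prob_zeta_coeff_def using supp N dirichlet_inverse_bound by blast
qed

theorem theorem1p1:
  shows "\<exists>(G :: (nat \<Rightarrow> nat) monoid) (T :: (nat \<Rightarrow> nat) topology).
           profinite_group G T \<and>
           \<not> prosoluble_group G T \<and>
           topologically_finitely_generated G T \<and>
           (\<forall>n\<ge>1. prob_zeta_coeff G T n \<ge> 0)"
proof -
  let ?S = "sym_group 5"
  let ?c = "prob_zeta_coeff ?S (disc ?S)" and ?A = "prime_factors (card (carrier ?S))"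
  have card: "card (carrier ?S) = fact 5" by (rule sym_group_card_carrier)
  have fin: "finite (carrier ?S)" by (rule card_ge_0_finite) (simp add: card)
  have grp: "group ?S" by (rule sym_group_is_group)
  \<comment> \<open>The exponent \<open>t\<close> depends on \<open>?S\<close> alone, so the growth
    exponent \<open>t + 2\<close> can be fixed before \<open>G\<close> is built.\<close>
  obtain t where t: "\<And>n. n \<ge> 1 \<Longrightarrow> \<bar>?c n\<bar> \<le> int n ^ t" using prob_zeta_coeff_bound[OF grp fin] by blast
  have "\<not> solvable ?S" by (rule sym_group_is_unsolvable) simp
  then obtain G E where ext: "growing_extension ?S (t + 2) ?A G E"
    using ex_growing_extension[OF grp fin, of ?A "t + 2"] by auto
  then have G: "group G" "finite (carrier G)" "\<not> solvable G" by (auto simp: growing_extension_def)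
  have "prob_zeta_coeff G (disc G) n \<ge> 0" if n: "n \<ge> 1" for n
  proof -
    \<comment> \<open>Indices of subgroups divide the order of \<open>?S\<close>, so nonzero
      coefficients of the inverse involve only the primes in \<open>?A\<close>, those at which
      \<open>E\<close> is known to grow.\<close>
    have "p \<in> ?A" if "?c n \<noteq> 0" "prime p" "p dvd n" for n p
    proof -
      have "p dvd card (carrier ?S)"
        using dirichlet_inverse_support[OF P_coeff_support[OF grp fin]] that unfolding prob_zeta_coeff_def by blast
      then show ?thesis using that(2) by (simp add: in_prime_factors_iff card)
    qed
    moreover have "?c 1 = 1" by (simp add: prob_zeta_coeff_def dirichlet_inverse.simps)
    ultimately have "dirichlet_convolution ?c E n \<ge> 0"
      using ext t n by (intro dirichlet_convolution_nonneg[where A = ?A and t = t]) (auto simp: growing_extension_def)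
    then show ?thesis using ext n by (simp add: growing_extension_def)
  qed
  then show ?thesis
    using finite_group_profinite[OF G(1,2)] finite_prosoluble_imp_solvable[OF G(1,2)] G
      finite_group_topologically_finitely_generated[OF G(1,2)] by blast
qed

end
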